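(* Let $X$ be a Grothendieck category with a small set of compact projective generators $S = \{ O_{\alpha} \}_{\alpha \in A}$. Every closed subcategory $Z$ of $X$ is generated by the objects $\{ O_{\alpha}/J_{\alpha} \}_{\alpha \in A}$ for a unique ideal $\{ J_{\alpha} \}_{\alpha\in A}$ in the set of generators $S$. Thus, there is a bijective correspondence between closed subcategories of $X$ and ideals in the set of generators $S$ (where the ideal $\{J_\alpha\}$ corresponds to the closed subcategory generated by $\{O_\alpha/J_\alpha\}$).
   Context: A Grothendieck category is an abelian category with arbitrary small direct sums, exact small filtered colimits, and a generator. A small set of objects $\{O_\alpha\}_{\alpha\in A}$ is a set of generators if $\bigoplus_\alpha O_\alpha$ is a generator, equivalently if every object of $X$ is an epimorphic image of a direct sum of objects taken from the set. An object $M$ is compact if $\operatorname{Hom}_X(M,-)$ commutes with arbitrary (small) direct sums. All subcategories are full. A full subcategory $Z$ of $X$ is weakly closed if it is closed under subobjects, quotient objects and small direct sums; it is closed if it is weakly closed and also closed under small products. The subcategory generated by a collection of objects is the full subcategory of all objects of $X$ that are quotient objects of direct sums of objects in the collection. An ideal in the set of generators $S=\{O_\alpha\}_{\alpha\in A}$ is a choice of subobject $J_\alpha \subseteq O_\alpha$ for each $\alpha\in A$ such that $f(J_\alpha)\subseteq J_\beta$ for every $\alpha,\beta \in A$ and every morphism $f: O_\alpha \to O_\beta$ in $X$. *)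

theory Defs
  imports "HOL-Algebra.Free_Abelian_Groups"
begin

unbundle cardinal_syntax

section \<open>Size\<close>

text \<open>
  Smallness is relative to a type \<open>'u\<close> of strongly inaccessible cardinality, which plays the role
  of a Grothendieck universe. Every small set is in bijection with a small subset of \<open>'u\<close>, so
  quantifying over small \<open>I :: 'u set\<close> covers all small families.
\<close>

definition inaccessible :: "'u itself \<Rightarrow> bool" where
  "inaccessible U \<longleftrightarrow>
     natLeq <o |UNIV :: 'u set| \<and> regularCard |UNIV :: 'u set| \<and>
     (\<forall>A :: 'u set. |A| <o |UNIV :: 'u set| \<longrightarrow> |Pow A| <o |UNIV :: 'u set| )"

definition small :: "'u itself \<Rightarrow> 'x set \<Rightarrow> bool" where
  "small U A \<longleftrightarrow> |A| <o |UNIV :: 'u set|"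


section \<open>Categories\<close>

record ('o, 'a) cat =
  Obj :: "'o set"
  Arr :: "'a set"
  Dom :: "'a \<Rightarrow> 'o"
  Cod :: "'a \<Rightarrow> 'o"
  Ide :: "'o \<Rightarrow> 'a"
  Comp :: "'a \<Rightarrow> 'a \<Rightarrow> 'a"  (infixl \<open>\<cdot>\<index>\<close> 70)

definition Hom :: "('o, 'a, 'm) cat_scheme \<Rightarrow> 'o \<Rightarrow> 'o \<Rightarrow> 'a set" where
  "Hom C a b = {f \<in> Arr C. Dom C f = a \<and> Cod C f = b}"

locale category =
  fixes C :: "('o, 'a, 'm) cat_scheme" (structure)
  assumes Dom_Obj: "f \<in> Arr C \<Longrightarrow> Dom C f \<in> Obj C"
    and Cod_Obj: "f \<in> Arr C \<Longrightarrow> Cod C f \<in> Obj C"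
    and Ide_Hom: "a \<in> Obj C \<Longrightarrow> Ide C a \<in> Hom C a a"
    and Comp_Hom: "f \<in> Hom C a b \<Longrightarrow> g \<in> Hom C b c \<Longrightarrow> g \<cdot> f \<in> Hom C a c"
    and Comp_Ide: "f \<in> Hom C a b \<Longrightarrow> f \<cdot> Ide C a = f"
    and Ide_Comp: "f \<in> Hom C a b \<Longrightarrow> Ide C b \<cdot> f = f"
    and Comp_assoc:
      "f \<in> Hom C a b \<Longrightarrow> g \<in> Hom C b c \<Longrightarrow> h \<in> Hom C c d \<Longrightarrow> (h \<cdot> g) \<cdot> f = h \<cdot> (g \<cdot> f)"

definition mono_arr :: "('o, 'a, 'm) cat_scheme \<Rightarrow> 'a \<Rightarrow> bool" where
  "mono_arr C m \<longleftrightarrow> m \<in> Arr C \<and>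
     (\<forall>a \<in> Obj C. \<forall>f \<in> Hom C a (Dom C m). \<forall>g \<in> Hom C a (Dom C m).
        m \<cdot>\<^bsub>C\<^esub> f = m \<cdot>\<^bsub>C\<^esub> g \<longrightarrow> f = g)"

definition epi_arr :: "('o, 'a, 'm) cat_scheme \<Rightarrow> 'a \<Rightarrow> bool" where
  "epi_arr C e \<longleftrightarrow> e \<in> Arr C \<and>
     (\<forall>b \<in> Obj C. \<forall>f \<in> Hom C (Cod C e) b. \<forall>g \<in> Hom C (Cod C e) b.
        f \<cdot>\<^bsub>C\<^esub> e = g \<cdot>\<^bsub>C\<^esub> e \<longrightarrow> f = g)"

definition is_coproduct ::
    "('o, 'a, 'm) cat_scheme \<Rightarrow> 'i set \<Rightarrow> ('i \<Rightarrow> 'o) \<Rightarrow> 'o \<Rightarrow> ('i \<Rightarrow> 'a) \<Rightarrow> bool" where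
  "is_coproduct C I F D \<iota> \<longleftrightarrow>
     D \<in> Obj C \<and> (\<forall>i \<in> I. F i \<in> Obj C \<and> \<iota> i \<in> Hom C (F i) D) \<and>
     (\<forall>T \<in> Obj C. \<forall>g. (\<forall>i \<in> I. g i \<in> Hom C (F i) T) \<longrightarrow>
        (\<exists>!h. h \<in> Hom C D T \<and> (\<forall>i \<in> I. h \<cdot>\<^bsub>C\<^esub> \<iota> i = g i)))"

definition is_product ::
    "('o, 'a, 'm) cat_scheme \<Rightarrow> 'i set \<Rightarrow> ('i \<Rightarrow> 'o) \<Rightarrow> 'o \<Rightarrow> ('i \<Rightarrow> 'a) \<Rightarrow> bool" where
  "is_product C I F P \<pi> \<longleftrightarrow>
     P \<in> Obj C \<and> (\<forall>i \<in> I. F i \<in> Obj C \<and> \<pi> i \<in> Hom C P (F i)) \<and>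
     (\<forall>T \<in> Obj C. \<forall>g. (\<forall>i \<in> I. g i \<in> Hom C T (F i)) \<longrightarrow>
        (\<exists>!h. h \<in> Hom C T P \<and> (\<forall>i \<in> I. \<pi> i \<cdot>\<^bsub>C\<^esub> h = g i)))"

definition zero_object :: "('o, 'a, 'm) cat_scheme \<Rightarrow> 'o \<Rightarrow> bool" where
  "zero_object C z \<longleftrightarrow>
     z \<in> Obj C \<and> (\<forall>a \<in> Obj C. (\<exists>!f. f \<in> Hom C z a) \<and> (\<exists>!f. f \<in> Hom C a z))"

definition generator :: "('o, 'a, 'm) cat_scheme \<Rightarrow> 'o \<Rightarrow> bool" where
  "generator C G \<longleftrightarrow> G \<in> Obj C \<and>
     (\<forall>a \<in> Obj C. \<forall>b \<in> Obj C. \<forall>f \<in> Hom C a b. \<forall>g \<in> Hom C a b.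
        f \<noteq> g \<longrightarrow> (\<exists>h \<in> Hom C G a. f \<cdot>\<^bsub>C\<^esub> h \<noteq> g \<cdot>\<^bsub>C\<^esub> h))"

definition projective :: "('o, 'a, 'm) cat_scheme \<Rightarrow> 'o \<Rightarrow> bool" where
  "projective C P \<longleftrightarrow> P \<in> Obj C \<and>
     (\<forall>e f. epi_arr C e \<and> f \<in> Hom C P (Cod C e) \<longrightarrow>
        (\<exists>g \<in> Hom C P (Dom C e). e \<cdot>\<^bsub>C\<^esub> g = f))"


section \<open>Filtered colimits\<close>

definition filtered :: "('j, 'k, 'n) cat_scheme \<Rightarrow> bool" where
  "filtered J \<longleftrightarrow> category J \<and> Obj J \<noteq> {} \<and>
     (\<forall>i \<in> Obj J. \<forall>j \<in> Obj J. \<exists>k \<in> Obj J. Hom J i k \<noteq> {} \<and> Hom J j k \<noteq> {}) \<and>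
     (\<forall>i \<in> Obj J. \<forall>j \<in> Obj J. \<forall>u \<in> Hom J i j. \<forall>v \<in> Hom J i j.
        \<exists>k \<in> Obj J. \<exists>w \<in> Hom J j k. w \<cdot>\<^bsub>J\<^esub> u = w \<cdot>\<^bsub>J\<^esub> v)"

definition is_functor ::
    "('j, 'k, 'n) cat_scheme \<Rightarrow> ('o, 'a, 'm) cat_scheme \<Rightarrow> ('j \<Rightarrow> 'o) \<Rightarrow> ('k \<Rightarrow> 'a) \<Rightarrow> bool" where
  "is_functor J C Fo Fa \<longleftrightarrow>
     (\<forall>j \<in> Obj J. Fo j \<in> Obj C) \<and>
     (\<forall>u \<in> Arr J. Fa u \<in> Hom C (Fo (Dom J u)) (Fo (Cod J u))) \<and>
     (\<forall>j \<in> Obj J. Fa (Ide J j) = Ide C (Fo j)) \<and>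
     (\<forall>u \<in> Arr J. \<forall>v \<in> Arr J. Cod J u = Dom J v \<longrightarrow> Fa (v \<cdot>\<^bsub>J\<^esub> u) = Fa v \<cdot>\<^bsub>C\<^esub> Fa u)"

definition is_nat_trans ::
    "('j, 'k, 'n) cat_scheme \<Rightarrow> ('o, 'a, 'm) cat_scheme \<Rightarrow> ('j \<Rightarrow> 'o) \<Rightarrow> ('k \<Rightarrow> 'a) \<Rightarrow>
     ('j \<Rightarrow> 'o) \<Rightarrow> ('k \<Rightarrow> 'a) \<Rightarrow> ('j \<Rightarrow> 'a) \<Rightarrow> bool" where
  "is_nat_trans J C Fo Fa Go Ga \<eta> \<longleftrightarrow>
     (\<forall>j \<in> Obj J. \<eta> j \<in> Hom C (Fo j) (Go j)) \<and>
     (\<forall>u \<in> Arr J. \<eta> (Cod J u) \<cdot>\<^bsub>C\<^esub> Fa u = Ga u \<cdot>\<^bsub>C\<^esub> \<eta> (Dom J u))"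

definition is_cocone ::
    "('j, 'k, 'n) cat_scheme \<Rightarrow> ('o, 'a, 'm) cat_scheme \<Rightarrow> ('j \<Rightarrow> 'o) \<Rightarrow> ('k \<Rightarrow> 'a) \<Rightarrow>
     'o \<Rightarrow> ('j \<Rightarrow> 'a) \<Rightarrow> bool" where
  "is_cocone J C Fo Fa L l \<longleftrightarrow>
     L \<in> Obj C \<and> (\<forall>j \<in> Obj J. l j \<in> Hom C (Fo j) L) \<and>
     (\<forall>u \<in> Arr J. l (Cod J u) \<cdot>\<^bsub>C\<^esub> Fa u = l (Dom J u))"

definition is_colimit ::
    "('j, 'k, 'n) cat_scheme \<Rightarrow> ('o, 'a, 'm) cat_scheme \<Rightarrow> ('j \<Rightarrow> 'o) \<Rightarrow> ('k \<Rightarrow> 'a) \<Rightarrow>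
     'o \<Rightarrow> ('j \<Rightarrow> 'a) \<Rightarrow> bool" where
  "is_colimit J C Fo Fa L l \<longleftrightarrow> is_cocone J C Fo Fa L l \<and>
     (\<forall>T \<tau>. is_cocone J C Fo Fa T \<tau> \<longrightarrow>
        (\<exists>!h. h \<in> Hom C L T \<and> (\<forall>j \<in> Obj J. h \<cdot>\<^bsub>C\<^esub> l j = \<tau> j)))"


section \<open>Abelian categories\<close>

text \<open>\<open>Zero C a b\<close> is the zero morphism from \<open>a\<close> to \<open>b\<close>; \<open>Plus C\<close> is the addition of parallel
  morphisms.\<close>

record ('o, 'a) add_cat = "('o, 'a) cat" +
  Zero :: "'o \<Rightarrow> 'o \<Rightarrow> 'a"
  Plus :: "'a \<Rightarrow> 'a \<Rightarrow> 'a"  (infixl \<open>\<oplus>\<oplus>\<index>\<close> 65)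

definition hom_group :: "('o, 'a, 'm) add_cat_scheme \<Rightarrow> 'o \<Rightarrow> 'o \<Rightarrow> 'a monoid" where
  "hom_group C a b = \<lparr>carrier = Hom C a b, monoid.mult = Plus C, one = Zero C a b\<rparr>"

locale preadditive_category = category C for C :: "('o, 'a, 'm) add_cat_scheme" (structure) +
  assumes hom_comm_group: "a \<in> Obj C \<Longrightarrow> b \<in> Obj C \<Longrightarrow> comm_group (hom_group C a b)"
    and Comp_Plus_right:
      "f \<in> Hom C a b \<Longrightarrow> g \<in> Hom C a b \<Longrightarrow> h \<in> Hom C b c \<Longrightarrow> h \<cdot> (f \<oplus>\<oplus> g) = h \<cdot> f \<oplus>\<oplus> h \<cdot> g"
    and Comp_Plus_left:
      "f \<in> Hom C b c \<Longrightarrow> g \<in> Hom C b c \<Longrightarrow> h \<in> Hom C a b \<Longrightarrow> (f \<oplus>\<oplus> g) \<cdot> h = f \<cdot> h \<oplus>\<oplus> g \<cdot> h"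

definition is_kernel :: "('o, 'a, 'm) add_cat_scheme \<Rightarrow> 'a \<Rightarrow> 'a \<Rightarrow> bool" where
  "is_kernel C f k \<longleftrightarrow>
     f \<in> Arr C \<and> k \<in> Arr C \<and> Cod C k = Dom C f \<and> f \<cdot>\<^bsub>C\<^esub> k = Zero C (Dom C k) (Cod C f) \<and>
     (\<forall>T \<in> Obj C. \<forall>g \<in> Hom C T (Dom C f). f \<cdot>\<^bsub>C\<^esub> g = Zero C T (Cod C f) \<longrightarrow>
        (\<exists>!h. h \<in> Hom C T (Dom C k) \<and> k \<cdot>\<^bsub>C\<^esub> h = g))"

definition is_cokernel :: "('o, 'a, 'm) add_cat_scheme \<Rightarrow> 'a \<Rightarrow> 'a \<Rightarrow> bool" where
  "is_cokernel C f q \<longleftrightarrow>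
     f \<in> Arr C \<and> q \<in> Arr C \<and> Dom C q = Cod C f \<and> q \<cdot>\<^bsub>C\<^esub> f = Zero C (Dom C f) (Cod C q) \<and>
     (\<forall>T \<in> Obj C. \<forall>g \<in> Hom C (Cod C f) T. g \<cdot>\<^bsub>C\<^esub> f = Zero C (Dom C f) T \<longrightarrow>
        (\<exists>!h. h \<in> Hom C (Cod C q) T \<and> h \<cdot>\<^bsub>C\<^esub> q = g))"

definition is_image :: "('o, 'a, 'm) add_cat_scheme \<Rightarrow> 'a \<Rightarrow> 'a \<Rightarrow> bool" where
  "is_image C f m \<longleftrightarrow> (\<exists>q. is_cokernel C f q \<and> is_kernel C q m)"

definition short_exact :: "('o, 'a, 'm) add_cat_scheme \<Rightarrow> 'a \<Rightarrow> 'a \<Rightarrow> bool" where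
  "short_exact C f g \<longleftrightarrow> is_kernel C g f \<and> is_cokernel C f g"

locale abelian_category = preadditive_category C
  for C :: "('o, 'a, 'm) add_cat_scheme" (structure) +
  assumes ex_zero_object: "\<exists>z. zero_object C z"
    and ex_binary_coproduct:
      "a \<in> Obj C \<Longrightarrow> b \<in> Obj C \<Longrightarrow>
       \<exists>D \<iota>. is_coproduct C (UNIV :: bool set) (\<lambda>i. if i then a else b) D \<iota>"
    and ex_kernel: "f \<in> Arr C \<Longrightarrow> \<exists>k. is_kernel C f k"
    and ex_cokernel: "f \<in> Arr C \<Longrightarrow> \<exists>q. is_cokernel C f q"
    and mono_normal: "mono_arr C m \<Longrightarrow> \<exists>f. is_kernel C f m"
    and epi_normal: "epi_arr C e \<Longrightarrow> \<exists>f. is_cokernel C f e"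


section \<open>Grothendieck categories\<close>

text \<open>As usual, the hom-sets of a category are required to be small. The exactness axiom says that
  taking colimits is an exact functor on the diagrams of shape \<open>J\<close>: in it, \<open>u\<close> and \<open>v\<close> are the
  morphisms of colimits induced by \<open>\<eta>\<close> and \<open>\<theta>\<close>.\<close>

locale grothendieck_category = abelian_category C
  for C :: "('o, 'a, 'm) add_cat_scheme" (structure) and U :: "'u itself" +
  assumes small_Hom: "a \<in> Obj C \<Longrightarrow> b \<in> Obj C \<Longrightarrow> small U (Hom C a b)"
    and ex_coproduct:
      "\<And>(I :: 'u set) F. small U I \<Longrightarrow> (\<forall>i \<in> I. F i \<in> Obj C) \<Longrightarrow> \<exists>D \<iota>. is_coproduct C I F D \<iota>"
    and ex_filtered_colimit:
      "\<And>(J :: ('u, 'u) cat) Fo Fa.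
         filtered J \<Longrightarrow> small U (Obj J) \<Longrightarrow> small U (Arr J) \<Longrightarrow> is_functor J C Fo Fa \<Longrightarrow>
         \<exists>L l. is_colimit J C Fo Fa L l"
    and filtered_colimit_exact:
      "\<And>(J :: ('u, 'u) cat) Fo Fa Go Ga Ho Ha \<eta> \<theta> L l M m N n u v.
         filtered J \<Longrightarrow> small U (Obj J) \<Longrightarrow> small U (Arr J) \<Longrightarrow>
         is_functor J C Fo Fa \<Longrightarrow> is_functor J C Go Ga \<Longrightarrow> is_functor J C Ho Ha \<Longrightarrow>
         is_nat_trans J C Fo Fa Go Ga \<eta> \<Longrightarrow> is_nat_trans J C Go Ga Ho Ha \<theta> \<Longrightarrow>
         (\<forall>j \<in> Obj J. short_exact C (\<eta> j) (\<theta> j)) \<Longrightarrow>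
         is_colimit J C Fo Fa L l \<Longrightarrow> is_colimit J C Go Ga M m \<Longrightarrow> is_colimit J C Ho Ha N n \<Longrightarrow>
         u \<in> Hom C L M \<Longrightarrow> (\<forall>j \<in> Obj J. u \<cdot> l j = m j \<cdot> \<eta> j) \<Longrightarrow>
         v \<in> Hom C M N \<Longrightarrow> (\<forall>j \<in> Obj J. v \<cdot> m j = n j \<cdot> \<theta> j) \<Longrightarrow>
         short_exact C u v"
    and ex_generator: "\<exists>G. generator C G"

definition set_of_generators ::
    "('o, 'a, 'm) cat_scheme \<Rightarrow> 'i set \<Rightarrow> ('i \<Rightarrow> 'o) \<Rightarrow> bool" where
  "set_of_generators C A P \<longleftrightarrow> (\<exists>D \<iota>. is_coproduct C A P D \<iota> \<and> generator C D)"

text \<open>The canonical homomorphism from the direct sum of the groups \<open>Hom(M, N\<^sub>i)\<close> to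
  \<open>Hom(M, \<Oplus>\<^sub>i N\<^sub>i)\<close> sends a finitely supported family \<open>f\<close> to the (finite) sum
  of the composites of the \<open>f i\<close> with the canonical injections.\<close>

definition compact_object :: "('o, 'a, 'm) add_cat_scheme \<Rightarrow> 'u itself \<Rightarrow> 'o \<Rightarrow> bool" where
  "compact_object C U M \<longleftrightarrow> M \<in> Obj C \<and>
     (\<forall>(I :: 'u set) N D \<iota>. small U I \<and> is_coproduct C I N D \<iota> \<longrightarrow>
        (\<lambda>f. gfinprod (hom_group C M D) (\<lambda>i. \<iota> i \<cdot>\<^bsub>C\<^esub> f i) I)
          \<in> iso (sum_group I (\<lambda>i. hom_group C M (N i))) (hom_group C M D))"


section \<open>Subcategories\<close>

text \<open>A full subcategory is given by its set of objects. Closure under subobjects (or quotient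
  objects) makes it closed under isomorphism.\<close>

definition weakly_closed_subcategory ::
    "('o, 'a, 'm) cat_scheme \<Rightarrow> 'u itself \<Rightarrow> 'o set \<Rightarrow> bool" where
  "weakly_closed_subcategory C U Z \<longleftrightarrow> Z \<subseteq> Obj C \<and>
     (\<forall>m. mono_arr C m \<and> Cod C m \<in> Z \<longrightarrow> Dom C m \<in> Z) \<and>
     (\<forall>e. epi_arr C e \<and> Dom C e \<in> Z \<longrightarrow> Cod C e \<in> Z) \<and>
     (\<forall>(I :: 'u set) F D \<iota>. small U I \<and> (\<forall>i \<in> I. F i \<in> Z) \<and> is_coproduct C I F D \<iota> \<longrightarrow> D \<in> Z)"

definition closed_subcategory ::
    "('o, 'a, 'm) cat_scheme \<Rightarrow> 'u itself \<Rightarrow> 'o set \<Rightarrow> bool" where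
  "closed_subcategory C U Z \<longleftrightarrow> weakly_closed_subcategory C U Z \<and>
     (\<forall>(I :: 'u set) F P \<pi>. small U I \<and> (\<forall>i \<in> I. F i \<in> Z) \<and> is_product C I F P \<pi> \<longrightarrow> P \<in> Z)"

definition generated_subcategory ::
    "('o, 'a, 'm) cat_scheme \<Rightarrow> 'u itself \<Rightarrow> 'o set \<Rightarrow> 'o set" where
  "generated_subcategory C U G =
     {M. \<exists>(I :: 'u set) F D \<iota> e. small U I \<and> (\<forall>i \<in> I. F i \<in> G) \<and> is_coproduct C I F D \<iota> \<and>
           epi_arr C e \<and> Dom C e = D \<and> Cod C e = M}"


section \<open>Subobjects and ideals\<close>

text \<open>A subobject of \<open>b\<close> is an equivalence class of monomorphisms into \<open>b\<close>.\<close>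

definition factors_through :: "('o, 'a, 'm) cat_scheme \<Rightarrow> 'a \<Rightarrow> 'a \<Rightarrow> bool" where
  "factors_through C f m \<longleftrightarrow> (\<exists>h \<in> Hom C (Dom C f) (Dom C m). f = m \<cdot>\<^bsub>C\<^esub> h)"

definition subobject_class :: "('o, 'a, 'm) cat_scheme \<Rightarrow> 'a \<Rightarrow> 'a set" where
  "subobject_class C m =
     {n. mono_arr C n \<and> Cod C n = Cod C m \<and> factors_through C n m \<and> factors_through C m n}"

definition subobjects :: "('o, 'a, 'm) cat_scheme \<Rightarrow> 'o \<Rightarrow> 'a set set" where
  "subobjects C b = {subobject_class C m |m. mono_arr C m \<and> Cod C m = b}"

text \<open>The inclusion of subobjects does not depend on the chosen representatives.\<close>

definition subobject_le :: "('o, 'a, 'm) cat_scheme \<Rightarrow> 'a set \<Rightarrow> 'a set \<Rightarrow> bool" where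
  "subobject_le C J K \<longleftrightarrow> (\<exists>m \<in> J. \<exists>n \<in> K. factors_through C m n)"

definition direct_image :: "('o, 'a, 'm) add_cat_scheme \<Rightarrow> 'a \<Rightarrow> 'a set \<Rightarrow> 'a set" where
  "direct_image C f J = {n. \<exists>m \<in> J. is_image C (f \<cdot>\<^bsub>C\<^esub> m) n}"

text \<open>The quotient of \<open>b\<close> by a subobject \<open>J\<close> of \<open>b\<close> is determined up to isomorphism.\<close>

definition quotient_object :: "('o, 'a, 'm) add_cat_scheme \<Rightarrow> 'a set \<Rightarrow> 'o" where
  "quotient_object C J = (SOME Q. \<exists>m \<in> J. \<exists>q. is_cokernel C m q \<and> Cod C q = Q)"

text \<open>Ideals are extensional functions on the index set, so that equality of ideals is equality of
  families of subobjects.\<close>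

definition is_ideal ::
    "('o, 'a, 'm) add_cat_scheme \<Rightarrow> 'i set \<Rightarrow> ('i \<Rightarrow> 'o) \<Rightarrow> ('i \<Rightarrow> 'a set) \<Rightarrow> bool" where
  "is_ideal C A P J \<longleftrightarrow> J \<in> (\<Pi>\<^sub>E \<alpha> \<in> A. subobjects C (P \<alpha>)) \<and>
     (\<forall>\<alpha> \<in> A. \<forall>\<beta> \<in> A. \<forall>f \<in> Hom C (P \<alpha>) (P \<beta>). subobject_le C (direct_image C f (J \<alpha>)) (J \<beta>))"

definition ideal_subcategory ::
    "('o, 'a, 'm) add_cat_scheme \<Rightarrow> 'u itself \<Rightarrow> 'i set \<Rightarrow> ('i \<Rightarrow> 'a set) \<Rightarrow> 'o set" where
  "ideal_subcategory C U A J = generated_subcategory C U ((\<lambda>\<alpha>. quotient_object C (J \<alpha>)) ` A)"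

end

theory Submission
  imports Defs
begin

text \<open>
  An ideal \<open>J\<close> determines the class of all \<open>M\<close> such that every \<open>P \<alpha> \<rightarrow> M\<close> vanishes on \<open>J \<alpha>\<close>.
  This class is clearly closed under subobjects and products; projectivity of the \<open>P \<alpha>\<close> gives
  quotients and compactness gives direct sums. By projectivity again, the ideal condition says that
  the \<open>P \<alpha> / J \<alpha>\<close> lie in the class, so that they generate it, and \<open>J \<alpha>\<close> is recovered as the least
  subobject of \<open>P \<alpha>\<close> whose quotient lies in the class. Conversely, in a closed subcategory such
  a least subobject exists, because an intersection of kernels is the kernel of a map to a product;
  that products exist is deduced from the projective generator \<open>\<Oplus>\<^sub>\<alpha> P \<alpha>\<close>.
\<close>

section \<open>Small sets\<close>

text \<open>Two reductions stand in for elements. Hom-sets are groups, so equality of two morphisms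
  becomes the vanishing of their difference; and a projective generator \<open>G\<close> detects
  vanishing on morphisms out of \<open>G\<close>, which moreover lift along epimorphisms.
  Injectivity and inclusions of kernels can then be tested on such points as in a module category.

  Products have to be constructed because closure under products in
  \<open>closed_subcategory\<close> speaks only of products that exist; without existence it could
  not produce the least subobject.

  Two encodings shape the rest. Smallness is measured against \<open>'u\<close>, and the definitions
  quantify over index sets in \<open>'u\<close>, while the natural index sets consist of morphisms,
  families or pairs; these are moved into \<open>'u\<close> along injections, and inaccessibility
  keeps power sets, function sets and dependent sums small. Also, \<open>quotient_object\<close>
  picks a quotient by \<open>SOME\<close>, for an unknown representative of the subobject. Hence
  monomorphisms \<open>j \<alpha>\<close> and cokernels \<open>q \<alpha>\<close> realising that
  choice are fixed, and ideals are studied through them.\<close>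

lemma small_inj:
  assumes "small (U :: 'u itself) A"
  obtains f :: "'x \<Rightarrow> 'u" where "inj_on f A"
proof -
  have "|A| \<le>o |UNIV :: 'u set|"
    using assms unfolding small_def by (rule ordLess_imp_ordLeq)
  then show ?thesis
    using that card_of_ordLeq[of A "UNIV :: 'u set"] by blast
qed

lemma small_image:
  assumes "small U A"
  shows "small U (f ` A)"
  using card_of_image[of f A] assms unfolding small_def by (rule ordLeq_ordLess_trans)

lemma small_if_inj_on:
  assumes "inj_on f A" "f ` A \<subseteq> B" "small U B"
  shows "small U A"
proof -
  have "|A| \<le>o |B|"
    using assms card_of_ordLeq[of A B] by blast
  then show ?thesis
    using assms(3) unfolding small_def by (rule ordLeq_ordLess_trans)
qed

text \<open>Exactly the regularity clause of \<open>inaccessible\<close>.\<close>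

lemma small_UNION:
  assumes "inaccessible (U :: 'u itself)" "small U I" "\<And>i. i \<in> I \<Longrightarrow> small U (A i)"
  shows "small U (\<Union>i\<in>I. A i)"
proof -
  have "infinite (UNIV :: 'u set)"
    using assms(1) ordLess_imp_ordLeq[of natLeq "|UNIV :: 'u set|"]
      infinite_iff_natLeq_ordLeq[of "UNIV :: 'u set"]
    unfolding inaccessible_def by blast
  then have "Cinfinite |UNIV :: 'u set|"
    by (simp add: cinfinite_def)
  then show ?thesis
    using regularCard_UNION_bound[of "|UNIV :: 'u set|" I A] assms
    unfolding small_def inaccessible_def by blast
qed

lemma small_Sigma:
  assumes "inaccessible U" "small U A" "\<And>a. a \<in> A \<Longrightarrow> small U (B a)"
  shows "small U (Sigma A B)"
proof -
  have "Sigma A B = (\<Union>a\<in>A. Pair a ` B a)"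
    by auto
  then show ?thesis
    using small_UNION[OF assms(1,2) small_image[OF assms(3)], of "\<lambda>a. a" Pair] by simp
qed

text \<open>The strong limit clause of \<open>inaccessible\<close> covers subsets of
  \<open>'u\<close> only, so \<open>A\<close> is first moved there by an injection.\<close>

lemma small_Pow:
  assumes "inaccessible (U :: 'u itself)" "small U A"
  shows "small U (Pow A)"
proof -
  obtain f :: "'a \<Rightarrow> 'u" where f: "inj_on f A"
    using assms(2) by (rule small_inj)
  have "small U (Pow (f ` A))"
    using small_image[OF assms(2), of f] assms(1) unfolding small_def inaccessible_def by blast
  then show ?thesis
    using small_if_inj_on[OF inj_on_image_Pow[OF f], of "Pow (f ` A)"] by blast
qed

text \<open>A function is encoded by its graph, a subset of the dependent sum; extensionality
  outside \<open>A\<close> makes this encoding injective.\<close>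

lemma small_PiE:
  assumes "inaccessible U" "small U A" "\<And>a. a \<in> A \<Longrightarrow> small U (B a)"
  shows "small U (Pi\<^sub>E A B)"
proof (rule small_if_inj_on)
  show "inj_on (\<lambda>f. (\<lambda>a. (a, f a)) ` A) (Pi\<^sub>E A B)"
  proof (rule inj_onI)
    fix f g
    assume fg: "f \<in> Pi\<^sub>E A B" "g \<in> Pi\<^sub>E A B"
      and eq: "(\<lambda>a. (a, f a)) ` A = (\<lambda>a. (a, g a)) ` A"
    have "f a = g a" if "a \<in> A" for a
      using eq that by blast
    then show "f = g"
      using fg by (intro PiE_ext)
  qed
  show "(\<lambda>f. (\<lambda>a. (a, f a)) ` A) ` Pi\<^sub>E A B \<subseteq> Pow (Sigma A B)"
    by (auto simp: PiE_def Pi_def)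
  show "small U (Pow (Sigma A B))"
    using small_Pow[OF assms(1) small_Sigma[OF assms]] .
qed


section \<open>Products and coproducts\<close>

context category
begin

lemma HomD:
  assumes "f \<in> Hom C a b"
  shows "f \<in> Arr C" "Dom C f = a" "Cod C f = b" "a \<in> Obj C" "b \<in> Obj C"
  using assms Dom_Obj Cod_Obj unfolding Hom_def by auto

lemma Arr_Hom: "f \<in> Arr C \<Longrightarrow> f \<in> Hom C (Dom C f) (Cod C f)"
  by (simp add: Hom_def)

lemma mono_cancel:
  assumes "mono_arr C m" "m \<in> Hom C b c" "f \<in> Hom C a b" "g \<in> Hom C a b" "m \<cdot> f = m \<cdot> g"
  shows "f = g"
  using assms HomD(2)[OF assms(2)] HomD(4)[OF assms(3)] unfolding mono_arr_def by metis

lemma epi_cancel: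
  assumes "epi_arr C e" "e \<in> Hom C a b" "f \<in> Hom C b c" "g \<in> Hom C b c" "f \<cdot> e = g \<cdot> e"
  shows "f = g"
  using assms HomD(3)[OF assms(2)] HomD(5)[OF assms(3)] unfolding epi_arr_def by metis

lemma projectiveD:
  assumes "projective C P" "epi_arr C e" "e \<in> Hom C a b" "f \<in> Hom C P b"
  obtains g where "g \<in> Hom C P a" "e \<cdot> g = f"
  using assms HomD[OF assms(3)] unfolding projective_def by metis

lemma factors_throughI:
  assumes "f \<in> Hom C a c" "m \<in> Hom C b c" "h \<in> Hom C a b" "f = m \<cdot> h"
  shows "factors_through C f m"
  using assms HomD(2)[OF assms(1)] HomD(2)[OF assms(2)] unfolding factors_through_def by auto

lemma factors_throughD:
  assumes "factors_through C f m" "f \<in> Hom C a c" "m \<in> Hom C b c"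
  obtains h where "h \<in> Hom C a b" "f = m \<cdot> h"
  using assms HomD(2)[OF assms(2)] HomD(2)[OF assms(3)] unfolding factors_through_def by auto

lemma factors_through_trans:
  assumes "factors_through C f g" "factors_through C g h" "Cod C g = Cod C h" "f \<in> Arr C"
    "g \<in> Arr C" "h \<in> Arr C"
  shows "factors_through C f h"
proof -
  obtain x y where x: "x \<in> Hom C (Dom C f) (Dom C g)" "f = g \<cdot> x"
    and y: "y \<in> Hom C (Dom C g) (Dom C h)" "g = h \<cdot> y"
    using assms unfolding factors_through_def by blast
  have "f = h \<cdot> (y \<cdot> x)"
    using Comp_assoc[OF x(1) y(1) Arr_Hom[OF assms(6)]] x y by simp
  then show ?thesis
    using Comp_Hom[OF x(1) y(1)] unfolding factors_through_def by blast
qed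

lemma coproductD:
  assumes "is_coproduct C I F D \<iota>"
  shows "D \<in> Obj C" "i \<in> I \<Longrightarrow> F i \<in> Obj C" "i \<in> I \<Longrightarrow> \<iota> i \<in> Hom C (F i) D"
  using assms unfolding is_coproduct_def by auto

lemma coproduct_copair:
  assumes "is_coproduct C I F D \<iota>" "T \<in> Obj C" "\<And>i. i \<in> I \<Longrightarrow> g i \<in> Hom C (F i) T"
  obtains h where "h \<in> Hom C D T" "\<And>i. i \<in> I \<Longrightarrow> h \<cdot> \<iota> i = g i"
  using assms unfolding is_coproduct_def by metis

lemma coproduct_eq:
  assumes cp: "is_coproduct C I F D \<iota>" and f: "f \<in> Hom C D T" and g: "g \<in> Hom C D T"
    and eq: "\<And>i. i \<in> I \<Longrightarrow> f \<cdot> \<iota> i = g \<cdot> \<iota> i"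
  shows "f = g"
proof -
  have "\<forall>i\<in>I. g \<cdot> \<iota> i \<in> Hom C (F i) T"
    using coproductD(3)[OF cp] Comp_Hom g by blast
  then have "\<exists>!h. h \<in> Hom C D T \<and> (\<forall>i\<in>I. h \<cdot> \<iota> i = g \<cdot> \<iota> i)"
    using cp HomD(5)[OF f] unfolding is_coproduct_def by simp
  then show ?thesis
    using f g eq by blast
qed

lemma productD:
  assumes "is_product C I F Q \<pi>"
  shows "Q \<in> Obj C" "i \<in> I \<Longrightarrow> F i \<in> Obj C" "i \<in> I \<Longrightarrow> \<pi> i \<in> Hom C Q (F i)"
  using assms unfolding is_product_def by auto

lemma product_pair:
  assumes "is_product C I F Q \<pi>" "T \<in> Obj C" "\<And>i. i \<in> I \<Longrightarrow> g i \<in> Hom C T (F i)"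
  obtains h where "h \<in> Hom C T Q" "\<And>i. i \<in> I \<Longrightarrow> \<pi> i \<cdot> h = g i"
  using assms unfolding is_product_def by metis

lemma product_eq:
  assumes cp: "is_product C I F Q \<pi>" and f: "f \<in> Hom C T Q" and g: "g \<in> Hom C T Q"
    and eq: "\<And>i. i \<in> I \<Longrightarrow> \<pi> i \<cdot> f = \<pi> i \<cdot> g"
  shows "f = g"
proof -
  have "\<forall>i\<in>I. \<pi> i \<cdot> g \<in> Hom C T (F i)"
    using productD(3)[OF cp] Comp_Hom g by blast
  then have "\<exists>!h. h \<in> Hom C T Q \<and> (\<forall>i\<in>I. \<pi> i \<cdot> h = \<pi> i \<cdot> g)"
    using cp HomD(4)[OF f] unfolding is_product_def by simp
  then show ?thesis
    using f g eq by blast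
qed

text \<open>Existence and closure axioms concern families indexed by subsets of \<open>'u\<close>.
  This lemma and its dual transfer them to small index sets of any type.\<close>

lemma is_coproduct_reindex:
  assumes cp: "is_coproduct C I F D \<iota>" and f: "bij_betw f S I"
  shows "is_coproduct C S (\<lambda>s. F (f s)) D (\<lambda>s. \<iota> (f s))"
  unfolding is_coproduct_def
proof (intro conjI ballI allI impI)
  show "D \<in> Obj C"
    by (rule coproductD(1)[OF cp])
  show "F (f s) \<in> Obj C" "\<iota> (f s) \<in> Hom C (F (f s)) D" if "s \<in> S" for s
    using coproductD(2,3)[OF cp] bij_betwE[OF f] that by auto
  fix T g
  assume T: "T \<in> Obj C" and g: "\<forall>s\<in>S. g s \<in> Hom C (F (f s)) T"
  have inv: "inv_into S f i \<in> S" "f (inv_into S f i) = i" if "i \<in> I" for i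
    using f that by (auto simp: bij_betw_def inv_into_into f_inv_into_f)
  have "g (inv_into S f i) \<in> Hom C (F i) T" if "i \<in> I" for i
    using g inv[OF that] by force
  then obtain h where h: "h \<in> Hom C D T" "\<And>i. i \<in> I \<Longrightarrow> h \<cdot> \<iota> i = g (inv_into S f i)"
    using coproduct_copair[OF cp T, of "\<lambda>i. g (inv_into S f i)"] by blast
  have "\<forall>s\<in>S. h \<cdot> \<iota> (f s) = g s"
    using h(2) bij_betwE[OF f] bij_betw_inv_into_left[OF f] by simp
  moreover have "h' = h" if "h' \<in> Hom C D T" "\<forall>s\<in>S. h' \<cdot> \<iota> (f s) = g s" for h'
  proof (rule coproduct_eq[OF cp that(1) h(1)])
    fix i assume "i \<in> I"
    then show "h' \<cdot> \<iota> i = h \<cdot> \<iota> i"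
      using that(2) h(2) inv by metis
  qed
  ultimately show "\<exists>!h. h \<in> Hom C D T \<and> (\<forall>s\<in>S. h \<cdot> \<iota> (f s) = g s)"
    using h(1) by blast
qed

lemma is_product_reindex:
  assumes cp: "is_product C I F Q \<pi>" and f: "bij_betw f S I"
  shows "is_product C S (\<lambda>s. F (f s)) Q (\<lambda>s. \<pi> (f s))"
  unfolding is_product_def
proof (intro conjI ballI allI impI)
  show "Q \<in> Obj C"
    by (rule productD(1)[OF cp])
  show "F (f s) \<in> Obj C" "\<pi> (f s) \<in> Hom C Q (F (f s))" if "s \<in> S" for s
    using productD(2,3)[OF cp] bij_betwE[OF f] that by auto
  fix T g
  assume T: "T \<in> Obj C" and g: "\<forall>s\<in>S. g s \<in> Hom C T (F (f s))"
  have inv: "inv_into S f i \<in> S" "f (inv_into S f i) = i" if "i \<in> I" for i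
    using f that by (auto simp: bij_betw_def inv_into_into f_inv_into_f)
  have "g (inv_into S f i) \<in> Hom C T (F i)" if "i \<in> I" for i
    using g inv[OF that] by force
  then obtain h where h: "h \<in> Hom C T Q" "\<And>i. i \<in> I \<Longrightarrow> \<pi> i \<cdot> h = g (inv_into S f i)"
    using product_pair[OF cp T, of "\<lambda>i. g (inv_into S f i)"] by blast
  have "\<forall>s\<in>S. \<pi> (f s) \<cdot> h = g s"
    using h(2) bij_betwE[OF f] bij_betw_inv_into_left[OF f] by simp
  moreover have "h' = h" if "h' \<in> Hom C T Q" "\<forall>s\<in>S. \<pi> (f s) \<cdot> h' = g s" for h'
  proof (rule product_eq[OF cp that(1) h(1)])
    fix i assume "i \<in> I"
    then show "\<pi> i \<cdot> h' = \<pi> i \<cdot> h"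
      using that(2) h(2) inv by metis
  qed
  ultimately show "\<exists>!h. h \<in> Hom C T Q \<and> (\<forall>s\<in>S. \<pi> (f s) \<cdot> h = g s)"
    using h(1) by blast
qed

lemma is_coproduct_cong:
  assumes "is_coproduct C I F D \<iota>" "\<And>i. i \<in> I \<Longrightarrow> F i = F' i"
  shows "is_coproduct C I F' D \<iota>"
  using assms unfolding is_coproduct_def by simp

text \<open>Lifts are chosen on each summand and glued by the universal property.\<close>

lemma projective_coproduct:
  assumes cp: "is_coproduct C I F D \<iota>" and pr: "\<And>i. i \<in> I \<Longrightarrow> projective C (F i)"
  shows "projective C D"
  unfolding projective_def
proof (intro conjI allI impI)
  show "D \<in> Obj C"
    by (rule coproductD(1)[OF cp])
  fix e f
  assume ef: "epi_arr C e \<and> f \<in> Hom C D (Cod C e)"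
  then have e: "e \<in> Hom C (Dom C e) (Cod C e)"
    using Arr_Hom unfolding epi_arr_def by blast
  have "\<exists>g. g \<in> Hom C (F i) (Dom C e) \<and> e \<cdot> g = f \<cdot> \<iota> i" if "i \<in> I" for i
    using projectiveD[OF pr[OF that], of e _ _ "f \<cdot> \<iota> i"] ef e
      Comp_Hom[OF coproductD(3)[OF cp that]] by metis
  then obtain g where g: "\<And>i. i \<in> I \<Longrightarrow> g i \<in> Hom C (F i) (Dom C e)"
      "\<And>i. i \<in> I \<Longrightarrow> e \<cdot> g i = f \<cdot> \<iota> i"
    by metis
  obtain h where h: "h \<in> Hom C D (Dom C e)" "\<And>i. i \<in> I \<Longrightarrow> h \<cdot> \<iota> i = g i"
    using coproduct_copair[OF cp HomD(4)[OF e] g(1)] by metis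
  have "e \<cdot> h = f"
  proof (rule coproduct_eq[OF cp Comp_Hom[OF h(1) e]])
    show "f \<in> Hom C D (Cod C e)" using ef by simp
    show "e \<cdot> h \<cdot> \<iota> i = f \<cdot> \<iota> i" if "i \<in> I" for i
      using Comp_assoc[OF coproductD(3)[OF cp that] h(1) e] h(2) g(2) that by simp
  qed
  then show "\<exists>g\<in>Hom C D (Dom C e). e \<cdot> g = f"
    using h(1) by blast
qed

section \<open>Subobjects as classes of mutually factoring monomorphisms\<close>

lemma subobject_class_mem:
  assumes "mono_arr C m"
  shows "m \<in> subobject_class C m"
proof -
  have m: "m \<in> Hom C (Dom C m) (Cod C m)"
    using assms Arr_Hom unfolding mono_arr_def by blast
  then have "factors_through C m m"
    using factors_throughI[OF m m Ide_Hom[OF HomD(4)[OF m]]] Comp_Ide[OF m] by simp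
  then show ?thesis
    using assms unfolding subobject_class_def by simp
qed

lemma subobject_class_eqI:
  assumes m: "mono_arr C m" and n: "mono_arr C n" and cod: "Cod C m = Cod C n"
    and mn: "factors_through C m n" and nm: "factors_through C n m"
  shows "subobject_class C m = subobject_class C n"
proof -
  have sub: "subobject_class C m' \<subseteq> subobject_class C n'"
    if "mono_arr C m'" "mono_arr C n'" "Cod C m' = Cod C n'"
      "factors_through C m' n'" "factors_through C n' m'" for m' n'
  proof
    fix x assume x: "x \<in> subobject_class C m'"
    have arr: "m' \<in> Arr C" "n' \<in> Arr C" "x \<in> Arr C"
      using that x unfolding mono_arr_def subobject_class_def by auto
    have "factors_through C x n'"
      using x factors_through_trans[of x m' n'] that arr unfolding subobject_class_def by simp
    moreover have "factors_through C n' x"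
      using x factors_through_trans[of n' m' x] that arr unfolding subobject_class_def by simp
    ultimately show "x \<in> subobject_class C n'"
      using x that unfolding subobject_class_def by simp
  qed
  show ?thesis
    using sub[OF assms] sub[OF n m cod[symmetric] nm mn] by blast
qed

end


section \<open>Abelian categories\<close>

context preadditive_category
begin

lemma Zero_Hom:
  assumes "a \<in> Obj C" "b \<in> Obj C"
  shows "Zero C a b \<in> Hom C a b"
proof -
  interpret comm_group "hom_group C a b"
    using hom_comm_group assms by blast
  show ?thesis
    using one_closed by (simp add: hom_group_def)
qed

text \<open>Source of the zero laws for composition: by bilinearity a composite with zero is
  idempotent under addition, and the only idempotent of a group is its unit.\<close>

lemma Plus_idem_Zero:
  assumes "f \<in> Hom C a b" "f \<oplus>\<oplus> f = f"
  shows "f = Zero C a b"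
proof -
  interpret comm_group "hom_group C a b"
    using hom_comm_group HomD(4,5)[OF assms(1)] by blast
  show ?thesis
    using r_cancel_one[of f f] assms by (simp add: hom_group_def)
qed

lemma Plus_Zero:
  assumes "a \<in> Obj C" "b \<in> Obj C"
  shows "Zero C a b \<oplus>\<oplus> Zero C a b = Zero C a b"
proof -
  interpret comm_group "hom_group C a b"
    using hom_comm_group assms by blast
  show ?thesis
    using l_one[of "Zero C a b"] Zero_Hom[OF assms] by (simp add: hom_group_def)
qed

lemma Comp_Zero:
  assumes "f \<in> Hom C b c" "a \<in> Obj C"
  shows "f \<cdot> Zero C a b = Zero C a c"
proof (rule Plus_idem_Zero)
  have z: "Zero C a b \<in> Hom C a b"
    using Zero_Hom HomD(4)[OF assms(1)] assms(2) by blast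
  show "f \<cdot> Zero C a b \<in> Hom C a c"
    using z assms(1) by (rule Comp_Hom)
  show "f \<cdot> Zero C a b \<oplus>\<oplus> f \<cdot> Zero C a b = f \<cdot> Zero C a b"
    using Comp_Plus_right[OF z z assms(1)] Plus_Zero[OF assms(2) HomD(4)[OF assms(1)]] by simp
qed

lemma Zero_Comp:
  assumes "f \<in> Hom C a b" "c \<in> Obj C"
  shows "Zero C b c \<cdot> f = Zero C a c"
proof (rule Plus_idem_Zero)
  have z: "Zero C b c \<in> Hom C b c"
    using Zero_Hom HomD(5)[OF assms(1)] assms(2) by blast
  show "Zero C b c \<cdot> f \<in> Hom C a c"
    using assms(1) z by (rule Comp_Hom)
  show "Zero C b c \<cdot> f \<oplus>\<oplus> Zero C b c \<cdot> f = Zero C b c \<cdot> f"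
    using Comp_Plus_left[OF z z assms(1)] Plus_Zero[OF HomD(5)[OF assms(1)] assms(2)] by simp
qed

text \<open>The category record has no subtraction; \<open>d\<close> plays the part of
  \<open>f - g\<close>, and only its defining equation is used afterwards.\<close>

lemma difference:
  assumes "f \<in> Hom C a b" "g \<in> Hom C a b"
  obtains d where "d \<in> Hom C a b" "d \<oplus>\<oplus> g = f"
proof -
  interpret comm_group "hom_group C a b"
    using hom_comm_group HomD(4,5)[OF assms(1)] by blast
  have g: "f \<in> carrier (hom_group C a b)" "g \<in> carrier (hom_group C a b)"
    using assms by (simp_all add: hom_group_def)
  then have "(f \<otimes>\<^bsub>hom_group C a b\<^esub> inv\<^bsub>hom_group C a b\<^esub> g) \<otimes>\<^bsub>hom_group C a b\<^esub> g = f"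
    by (simp add: m_assoc)
  moreover have "f \<otimes>\<^bsub>hom_group C a b\<^esub> inv\<^bsub>hom_group C a b\<^esub> g \<in> carrier (hom_group C a b)"
    using g by simp
  ultimately show ?thesis
    using that by (simp add: hom_group_def)
qed

lemma Plus_cancel_Zero:
  assumes "d \<in> Hom C a b" "g \<in> Hom C a b"
  shows "d \<oplus>\<oplus> g = g \<longleftrightarrow> d = Zero C a b"
proof -
  interpret comm_group "hom_group C a b"
    using hom_comm_group HomD(4,5)[OF assms(1)] by blast
  show ?thesis
    using r_cancel_one[of g d] assms by (simp add: hom_group_def)
qed

lemma monoI:
  assumes m: "m \<in> Hom C b c"
    and z: "\<And>a x. x \<in> Hom C a b \<Longrightarrow> m \<cdot> x = Zero C a c \<Longrightarrow> x = Zero C a b"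
  shows "mono_arr C m"
  unfolding mono_arr_def
proof (intro conjI ballI impI)
  show "m \<in> Arr C" using HomD(1)[OF m] .
  fix a f g
  assume "f \<in> Hom C a (Dom C m)" "g \<in> Hom C a (Dom C m)" and eq: "m \<cdot> f = m \<cdot> g"
  then have f: "f \<in> Hom C a b" and g: "g \<in> Hom C a b"
    using HomD(2)[OF m] by auto
  obtain d where d: "d \<in> Hom C a b" "d \<oplus>\<oplus> g = f"
    using difference[OF f g] .
  have "m \<cdot> d \<oplus>\<oplus> m \<cdot> g = m \<cdot> g"
    using Comp_Plus_right[OF d(1) g m] eq d by simp
  then have "d = Zero C a b"
    using Plus_cancel_Zero[OF Comp_Hom[OF d(1) m] Comp_Hom[OF g m]] z d by simp
  then show "f = g"
    using Plus_cancel_Zero[OF d(1) g] d by simp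
qed

lemma epiI:
  assumes e: "e \<in> Hom C a b"
    and z: "\<And>c x. x \<in> Hom C b c \<Longrightarrow> x \<cdot> e = Zero C a c \<Longrightarrow> x = Zero C b c"
  shows "epi_arr C e"
  unfolding epi_arr_def
proof (intro conjI ballI impI)
  show "e \<in> Arr C" using HomD(1)[OF e] .
  fix c f g
  assume "f \<in> Hom C (Cod C e) c" "g \<in> Hom C (Cod C e) c" and eq: "f \<cdot> e = g \<cdot> e"
  then have f: "f \<in> Hom C b c" and g: "g \<in> Hom C b c"
    using HomD(3)[OF e] by auto
  obtain d where d: "d \<in> Hom C b c" "d \<oplus>\<oplus> g = f"
    using difference[OF f g] .
  have "d \<cdot> e \<oplus>\<oplus> g \<cdot> e = g \<cdot> e"
    using Comp_Plus_left[OF d(1) g e] eq d by simp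
  then have "d = Zero C b c"
    using Plus_cancel_Zero[OF Comp_Hom[OF e d(1)] Comp_Hom[OF e g]] z d by simp
  then show "f = g"
    using Plus_cancel_Zero[OF d(1) g] d by simp
qed

section \<open>Kernels and cokernels\<close>

lemma kernelD:
  assumes "is_kernel C f k" "f \<in> Hom C a b"
  shows "k \<in> Hom C (Dom C k) a" "f \<cdot> k = Zero C (Dom C k) b"
  using assms HomD[OF assms(2)] unfolding is_kernel_def Hom_def by auto

lemma kernel_factor:
  assumes "is_kernel C f k" "f \<in> Hom C a b" "g \<in> Hom C t a" "f \<cdot> g = Zero C t b"
  obtains h where "h \<in> Hom C t (Dom C k)" "k \<cdot> h = g"
  using assms HomD[OF assms(2)] HomD(4)[OF assms(3)] unfolding is_kernel_def by metis

lemma kernel_mono: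
  assumes "is_kernel C f k"
  shows "mono_arr C k"
proof -
  have f: "f \<in> Hom C (Dom C f) (Cod C f)"
    using assms Arr_Hom unfolding is_kernel_def by blast
  note k = kernelD[OF assms f]
  have u: "\<exists>!h. h \<in> Hom C t (Dom C k) \<and> k \<cdot> h = g"
    if "g \<in> Hom C t (Dom C f)" "f \<cdot> g = Zero C t (Cod C f)" for t g
    using assms that HomD(4)[OF that(1)] unfolding is_kernel_def by blast
  show ?thesis
    unfolding mono_arr_def
  proof (intro conjI ballI impI)
    show "k \<in> Arr C" using HomD(1)[OF k(1)] .
    fix a x y
    assume xy: "x \<in> Hom C a (Dom C k)" "y \<in> Hom C a (Dom C k)" "k \<cdot> x = k \<cdot> y"
    have "f \<cdot> (k \<cdot> y) = Zero C a (Cod C f)"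
      using Comp_assoc[OF xy(2) k(1) f] k(2) Zero_Comp[OF xy(2) HomD(5)[OF f]] by simp
    then show "x = y"
      using u[OF Comp_Hom[OF xy(2) k(1)]] xy by blast
  qed
qed

lemma cokernelD:
  assumes "is_cokernel C f q" "f \<in> Hom C a b"
  shows "q \<in> Hom C b (Cod C q)" "q \<cdot> f = Zero C a (Cod C q)"
  using assms HomD[OF assms(2)] unfolding is_cokernel_def Hom_def by auto

lemma cokernel_factor:
  assumes "is_cokernel C f q" "f \<in> Hom C a b" "g \<in> Hom C b t" "g \<cdot> f = Zero C a t"
  obtains h where "h \<in> Hom C (Cod C q) t" "h \<cdot> q = g"
  using assms HomD[OF assms(2)] HomD(5)[OF assms(3)] unfolding is_cokernel_def by metis

lemma cokernel_epi:
  assumes "is_cokernel C f q"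
  shows "epi_arr C q"
proof -
  have f: "f \<in> Hom C (Dom C f) (Cod C f)"
    using assms Arr_Hom unfolding is_cokernel_def by blast
  note q = cokernelD[OF assms f]
  have u: "\<exists>!h. h \<in> Hom C (Cod C q) t \<and> h \<cdot> q = g"
    if "g \<in> Hom C (Cod C f) t" "g \<cdot> f = Zero C (Dom C f) t" for t g
    using assms that HomD(5)[OF that(1)] unfolding is_cokernel_def by blast
  show ?thesis
    unfolding epi_arr_def
  proof (intro conjI ballI impI)
    show "q \<in> Arr C" using HomD(1)[OF q(1)] .
    fix a x y
    assume xy: "x \<in> Hom C (Cod C q) a" "y \<in> Hom C (Cod C q) a" "x \<cdot> q = y \<cdot> q"
    have "y \<cdot> q \<cdot> f = Zero C (Dom C f) a"
      using Comp_assoc[OF f q(1) xy(2)] q(2) Comp_Zero[OF xy(2) HomD(4)[OF f]] by simp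
    then show "x = y"
      using u[OF Comp_Hom[OF q(1) xy(2)]] xy by blast
  qed
qed

end

context abelian_category
begin

text \<open>A monomorphism is the kernel of its own cokernel. By normality \<open>m\<close> is a
  kernel of some \<open>f\<close>; as \<open>f\<close> kills \<open>m\<close>, it factors through
  \<open>q\<close>, so whatever \<open>q\<close> kills is killed by \<open>f\<close> as
  well.\<close>

lemma mono_factor_cokernel:
  assumes m: "mono_arr C m" "m \<in> Hom C a b" and q: "is_cokernel C m q"
    and g: "g \<in> Hom C t b" "q \<cdot> g = Zero C t (Cod C q)"
  obtains h where "h \<in> Hom C t a" "m \<cdot> h = g"
proof -
  obtain f where f: "is_kernel C f m"
    using mono_normal m by blast
  then have fH: "f \<in> Hom C b (Cod C f)"
    using HomD(3)[OF m(2)] unfolding is_kernel_def Hom_def by simp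
  have "f \<cdot> m = Zero C a (Cod C f)"
    using kernelD(2)[OF f fH] HomD(2)[OF m(2)] by simp
  then obtain h where h: "h \<in> Hom C (Cod C q) (Cod C f)" "h \<cdot> q = f"
    using cokernel_factor[OF q m(2) fH] by blast
  have "f \<cdot> g = Zero C t (Cod C f)"
    using Comp_assoc[OF g(1) cokernelD(1)[OF q m(2)] h(1)] g(2) h
      Comp_Zero[OF h(1) HomD(4)[OF g(1)]] by simp
  then show ?thesis
    using kernel_factor[OF f fH g(1)] that HomD(2)[OF m(2)] by metis
qed

text \<open>The dual fact that an epimorphism is the cokernel of its kernel. It lets a morphism
  defined on a covering coproduct descend to the covered object.\<close>

lemma epi_factor_kernel:
  assumes e: "epi_arr C e" "e \<in> Hom C a b" and k: "is_kernel C e k"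
    and g: "g \<in> Hom C a t" "g \<cdot> k = Zero C (Dom C k) t"
  obtains h where "h \<in> Hom C b t" "h \<cdot> e = g"
proof -
  obtain f where f: "is_cokernel C f e"
    using epi_normal e by blast
  then have fH: "f \<in> Hom C (Dom C f) a"
    using HomD(2)[OF e(2)] unfolding is_cokernel_def Hom_def by simp
  have "e \<cdot> f = Zero C (Dom C f) b"
    using cokernelD(2)[OF f fH] HomD(3)[OF e(2)] by simp
  then obtain h where h: "h \<in> Hom C (Dom C f) (Dom C k)" "k \<cdot> h = f"
    using kernel_factor[OF k e(2) fH] by blast
  have "g \<cdot> f = Zero C (Dom C f) t"
    using Comp_assoc[OF h(1) kernelD(1)[OF k e(2)] g(1)] g(2) h
      Zero_Comp[OF h(1) HomD(5)[OF g(1)]] by simp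
  then show ?thesis
    using cokernel_factor[OF f fH g(1)] that HomD(3)[OF e(2)] by metis
qed

text \<open>The object chosen by \<open>SOME\<close> is a cokernel of some member of the class, not
  necessarily of the monomorphism that was given. The representative is therefore exchanged for that
  member, which has the same class.\<close>

lemma quotient_object_cokernel:
  assumes "J \<in> subobjects C b"
  obtains m q where "J = subobject_class C m" "mono_arr C m" "Cod C m = b" "is_cokernel C m q"
    "Cod C q = quotient_object C J"
proof -
  obtain n where n: "mono_arr C n" "Cod C n = b" "J = subobject_class C n"
    using assms unfolding subobjects_def by blast
  then have "\<exists>Q. \<exists>m\<in>J. \<exists>q. is_cokernel C m q \<and> Cod C q = Q"
    using ex_cokernel subobject_class_mem unfolding mono_arr_def by metis
  then have "\<exists>m\<in>J. \<exists>q. is_cokernel C m q \<and> Cod C q = quotient_object C J"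
    unfolding quotient_object_def by (rule someI_ex)
  then obtain m q where mq: "m \<in> J" "is_cokernel C m q" "Cod C q = quotient_object C J"
    by blast
  then have "mono_arr C m" "Cod C m = Cod C n" "factors_through C m n" "factors_through C n m"
    using n(3) unfolding subobject_class_def by auto
  then show ?thesis
    using that[of m q] mq n subobject_class_eqI by metis
qed

text \<open>Images disappear from the ideal condition. The image \<open>i\<close> is the kernel of
  the cokernel of \<open>f \<cdot> m\<close>, so \<open>f \<cdot> m\<close> factors through
  \<open>i\<close>. Conversely, if \<open>f \<cdot> m\<close> factors through \<open>n\<close>, the
  cokernel of \<open>n\<close> factors through that of \<open>f \<cdot> m\<close> and hence kills
  \<open>i\<close>, so \<open>i\<close> factors through \<open>n\<close>.\<close>

lemma subobject_le_direct_image_iff: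
  assumes m: "mono_arr C m" "Cod C m = a" and n: "mono_arr C n" "Cod C n = b"
    and f: "f \<in> Hom C a b"
  shows "subobject_le C (direct_image C f (subobject_class C m)) (subobject_class C n) \<longleftrightarrow>
    factors_through C (f \<cdot> m) n"
proof -
  have mH: "m \<in> Hom C (Dom C m) a" and nH: "n \<in> Hom C (Dom C n) b"
    using m n Arr_Hom[of m] Arr_Hom[of n] unfolding mono_arr_def by auto
  show ?thesis
  proof
    assume "subobject_le C (direct_image C f (subobject_class C m)) (subobject_class C n)"
    \<comment> \<open>The inclusion only provides some representatives \<open>m'\<close> and
      \<open>n'\<close>; the changes to \<open>m\<close> and \<open>n\<close> are undone by
      composing with the factorisations.\<close>
    then obtain m' i n' where m': "m' \<in> subobject_class C m" "is_image C (f \<cdot> m') i"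
      and n': "n' \<in> subobject_class C n" "factors_through C i n'"
      unfolding subobject_le_def direct_image_def by blast
    have m'H: "m' \<in> Hom C (Dom C m') a" and mm': "factors_through C m m'"
      using m'(1) m(2) Arr_Hom[of m'] unfolding subobject_class_def mono_arr_def by auto
    have n'H: "n' \<in> Hom C (Dom C n') b" and nn': "factors_through C n' n"
      using n'(1) n(2) Arr_Hom[of n'] unfolding subobject_class_def mono_arr_def by auto
    have fm': "f \<cdot> m' \<in> Hom C (Dom C m') b"
      using Comp_Hom[OF m'H f] .
    obtain q where q: "is_cokernel C (f \<cdot> m') q" "is_kernel C q i"
      using m'(2) unfolding is_image_def by blast
    note qH = cokernelD[OF q(1) fm']
    note iH = kernelD[OF q(2) qH(1)]
    obtain h where h: "h \<in> Hom C (Dom C m') (Dom C i)" "i \<cdot> h = f \<cdot> m'"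
      using kernel_factor[OF q(2) qH(1) fm' qH(2)] .
    obtain x where x: "x \<in> Hom C (Dom C m) (Dom C m')" "m = m' \<cdot> x"
      using factors_throughD[OF mm' mH m'H] .
    have "f \<cdot> m = (f \<cdot> m') \<cdot> x"
      using Comp_assoc[OF x(1) m'H f] x(2) by simp
    also have "\<dots> = i \<cdot> (h \<cdot> x)"
      using Comp_assoc[OF x(1) h(1) iH(1)] h(2) by simp
    finally have "factors_through C (f \<cdot> m) i"
      using factors_throughI[OF Comp_Hom[OF mH f] iH(1) Comp_Hom[OF x(1) h(1)]] by blast
    moreover have "factors_through C i n"
      using factors_through_trans[OF n'(2) nn'] HomD[OF n'H] HomD[OF nH] HomD[OF iH(1)] by simp
    ultimately show "factors_through C (f \<cdot> m) n"
      using factors_through_trans HomD[OF Comp_Hom[OF mH f]] HomD[OF nH] HomD[OF iH(1)] by metis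
  next
    assume fac: "factors_through C (f \<cdot> m) n"
    have fm: "f \<cdot> m \<in> Hom C (Dom C m) b"
      using Comp_Hom[OF mH f] .
    obtain h where h: "h \<in> Hom C (Dom C m) (Dom C n)" "f \<cdot> m = n \<cdot> h"
      using factors_throughD[OF fac fm nH] .
    obtain q where q: "is_cokernel C (f \<cdot> m) q"
      using ex_cokernel HomD(1)[OF fm] by blast
    note qH = cokernelD[OF q fm]
    obtain i where i: "is_kernel C q i"
      using ex_kernel HomD(1)[OF qH(1)] by blast
    note iH = kernelD[OF i qH(1)]
    obtain r where r: "is_cokernel C n r"
      using ex_cokernel HomD(1)[OF nH] by blast
    note rH = cokernelD[OF r nH]
    have "r \<cdot> (f \<cdot> m) = Zero C (Dom C m) (Cod C r)"
      using Comp_assoc[OF h(1) nH rH(1)] rH(2) h Zero_Comp[OF h(1) HomD(5)[OF rH(1)]] by simp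
    then obtain s where s: "s \<in> Hom C (Cod C q) (Cod C r)" "s \<cdot> q = r"
      using cokernel_factor[OF q fm rH(1)] by blast
    have "r \<cdot> i = Zero C (Dom C i) (Cod C r)"
      using Comp_assoc[OF iH(1) qH(1) s(1)] s iH(2) Comp_Zero[OF s(1) HomD(4)[OF iH(1)]] by simp
    then obtain t where "t \<in> Hom C (Dom C i) (Dom C n)" "n \<cdot> t = i"
      using mono_factor_cokernel[OF n(1) nH r iH(1)] by blast
    then have "factors_through C i n"
      using factors_throughI[OF iH(1) nH] by blast
    moreover have "i \<in> direct_image C f (subobject_class C m)"
      using q i subobject_class_mem[OF m(1)] unfolding direct_image_def is_image_def by blast
    ultimately show "subobject_le C (direct_image C f (subobject_class C m)) (subobject_class C n)"
      using subobject_class_mem[OF n(1)] unfolding subobject_le_def by blast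
  qed
qed

end


section \<open>Small products and coproducts\<close>

context category
begin

text \<open>Removes the restriction to index sets in \<open>'u\<close> from the definition of a
  closed subcategory.\<close>

lemma closed_product:
  assumes Z: "closed_subcategory C (U :: 'u itself) Z" and S: "small U S"
    and F: "\<And>s. s \<in> S \<Longrightarrow> F s \<in> Z" and p: "is_product C S F Q \<pi>"
  shows "Q \<in> Z"
proof -
  obtain f :: "_ \<Rightarrow> 'u" where f: "inj_on f S"
    using S by (rule small_inj)
  have "bij_betw (inv_into S f) (f ` S) S"
    using f by (intro bij_betw_inv_into) (simp add: bij_betw_def)
  note cp' = is_product_reindex[OF p this]
  have FZ: "\<forall>i\<in>f ` S. F (inv_into S f i) \<in> Z"
    using F inv_into_into[of _ f S] by blast
  have "\<forall>(I :: 'u set) F Q \<pi>. small U I \<and> (\<forall>i\<in>I. F i \<in> Z) \<and> is_product C I F Q \<pi> \<longrightarrow> Q \<in> Z"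
    using Z unfolding closed_subcategory_def by simp
  note this[THEN spec, of "f ` S", THEN spec, of "\<lambda>i. F (inv_into S f i)", THEN spec, of Q,
    THEN spec, of "\<lambda>i. \<pi> (inv_into S f i)"]
  then show ?thesis
    using cp' FZ small_image[OF S, of f] by blast
qed

lemma generated_subcategoryI:
  assumes S: "small (U :: 'u itself) S" and F: "\<And>s. s \<in> S \<Longrightarrow> F s \<in> Q"
    and cp: "is_coproduct C S F D \<iota>" and e: "epi_arr C e" "e \<in> Hom C D M"
  shows "M \<in> generated_subcategory C U Q"
proof -
  obtain f :: "_ \<Rightarrow> 'u" where f: "inj_on f S"
    using S by (rule small_inj)
  have "bij_betw (inv_into S f) (f ` S) S"
    using f by (intro bij_betw_inv_into) (simp add: bij_betw_def)
  note cp' = is_coproduct_reindex[OF cp this]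
  have FZ: "\<forall>i\<in>f ` S. F (inv_into S f i) \<in> Q"
    using F inv_into_into[of _ f S] by blast
  show ?thesis
    using cp' FZ small_image[OF S, of f] e(1) HomD(2,3)[OF e(2)] unfolding generated_subcategory_def
    by (intro CollectI exI[of _ "f ` S"] exI[of _ "\<lambda>i. F (inv_into S f i)"] exI[of _ D]
        exI[of _ "\<lambda>i. \<iota> (inv_into S f i)"] exI[of _ e]) blast
qed

lemma epi_of_comp:
  assumes e: "epi_arr C (s \<cdot> q)" and q: "q \<in> Hom C a b" and s: "s \<in> Hom C b c"
  shows "epi_arr C s"
  unfolding epi_arr_def
proof (intro conjI ballI impI)
  show "s \<in> Arr C" using HomD(1)[OF s] .
  fix d f g
  assume "f \<in> Hom C (Cod C s) d" "g \<in> Hom C (Cod C s) d" and eq: "f \<cdot> s = g \<cdot> s"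
  then have f: "f \<in> Hom C c d" and g: "g \<in> Hom C c d"
    using HomD(3)[OF s] by auto
  show "f = g"
    using epi_cancel[OF e Comp_Hom[OF q s] f g] Comp_assoc[OF q s f] Comp_assoc[OF q s g] eq
    by simp
qed

end

section \<open>Testing on points of a projective generator\<close>

context preadditive_category
begin

lemma generator_separates:
  assumes "generator C G" "x \<in> Hom C a b" "\<And>h. h \<in> Hom C G a \<Longrightarrow> x \<cdot> h = Zero C G b"
  shows "x = Zero C a b"
proof (rule ccontr)
  assume "x \<noteq> Zero C a b"
  then obtain h where h: "h \<in> Hom C G a" "x \<cdot> h \<noteq> Zero C a b \<cdot> h"
    using assms(1,2) Zero_Hom HomD(4,5)[OF assms(2)] unfolding generator_def by metis
  then show False
    using assms(3) Zero_Comp[OF h(1) HomD(5)[OF assms(2)]] by simp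
qed

lemma generator_monoI:
  assumes G: "generator C G" and m: "m \<in> Hom C b c"
    and z: "\<And>x. x \<in> Hom C G b \<Longrightarrow> m \<cdot> x = Zero C G c \<Longrightarrow> x = Zero C G b"
  shows "mono_arr C m"
proof (rule monoI[OF m])
  fix a x
  assume x: "x \<in> Hom C a b" "m \<cdot> x = Zero C a c"
  show "x = Zero C a b"
  proof (rule generator_separates[OF G x(1)])
    fix h assume h: "h \<in> Hom C G a"
    have "m \<cdot> (x \<cdot> h) = Zero C G c"
      using Comp_assoc[OF h x(1) m] x(2) Zero_Comp[OF h HomD(5)[OF m]] by simp
    then show "x \<cdot> h = Zero C G b"
      by (rule z[OF Comp_Hom[OF h x(1)]])
  qed
qed

text \<open>A point of the coimage killed by \<open>g\<close> lifts along the epimorphism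
  \<open>q\<close> because \<open>G\<close> is projective. The lift is killed by \<open>f\<close>,
  so it comes from the kernel \<open>k\<close>, and \<open>q\<close> kills \<open>k\<close>.\<close>

lemma coimage_mono:
  assumes G: "generator C G" "projective C G" and f: "f \<in> Hom C a b" and k: "is_kernel C f k"
    and q: "is_cokernel C k q" and g: "g \<in> Hom C (Cod C q) b" "g \<cdot> q = f"
  shows "mono_arr C g"
proof (rule generator_monoI[OF G(1) g(1)])
  fix x assume x: "x \<in> Hom C G (Cod C q)" "g \<cdot> x = Zero C G b"
  note kH = kernelD[OF k f]
  note qH = cokernelD[OF q kH(1)]
  obtain y where y: "y \<in> Hom C G a" "q \<cdot> y = x"
    using projectiveD[OF G(2) cokernel_epi[OF q] qH(1) x(1)] .
  have "f \<cdot> y = Zero C G b"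
    using Comp_assoc[OF y(1) qH(1) g(1)] g(2) y(2) x(2) by simp
  then obtain z where z: "z \<in> Hom C G (Dom C k)" "k \<cdot> z = y"
    using kernel_factor[OF k f y(1)] by blast
  show "x = Zero C G (Cod C q)"
    using Comp_assoc[OF z(1) kH(1) qH(1)] z(2) y(2) qH(2) Zero_Comp[OF z(1) HomD(5)[OF qH(1)]]
    by simp
qed

lemma gfinprod_Comp_Zero:
  assumes k: "k \<in> Hom C c a" and b: "b \<in> Obj C"
    and y: "\<And>i. i \<in> I \<Longrightarrow> y i \<in> Hom C a b" "\<And>i. i \<in> I \<Longrightarrow> y i \<cdot> k = Zero C c b"
  shows "gfinprod (hom_group C a b) y I \<cdot> k = Zero C c b"
proof -
  interpret comm_group "hom_group C a b"
    using hom_comm_group HomD(5)[OF k] b by blast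
  have carr: "carrier (hom_group C a b) = Hom C a b"
    by (simp add: hom_group_def)
  \<comment> \<open>\<open>gfinprod\<close> is the group unit when the support is infinite, so the
    unit needs its own case besides the finite sums.\<close>
  have one_k: "\<one>\<^bsub>hom_group C a b\<^esub> \<cdot> k = Zero C c b"
    using Zero_Comp[OF k b] by (simp add: hom_group_def)
  have fin: "finprod (hom_group C a b) y B \<cdot> k = Zero C c b" if "finite B" "B \<subseteq> I" for B
    using that
  proof (induction B rule: finite_induct)
    case empty
    then show ?case
      using one_k by simp
  next
    case (insert i B)
    have yB: "y \<in> B \<rightarrow> carrier (hom_group C a b)" and yi: "y i \<in> carrier (hom_group C a b)"
      using insert.prems y(1) carr by auto
    have "finprod (hom_group C a b) y (insert i B) = y i \<oplus>\<oplus> finprod (hom_group C a b) y B"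
      using finprod_insert[OF insert.hyps yB yi] by (simp add: hom_group_def)
    moreover have "finprod (hom_group C a b) y B \<in> Hom C a b"
      using finprod_closed[OF yB] carr by simp
    ultimately show ?case
      using Comp_Plus_left[OF _ _ k, of "y i" b] yi carr insert y(2)[of i]
        Plus_Zero[OF HomD(4)[OF k] b] by simp
  qed
  show ?thesis
    using one_k fin unfolding gfinprod_def by auto
qed

end

context grothendieck_category
begin

lemma ex_small_coproduct:
  assumes S: "small U S" and F: "\<And>s. s \<in> S \<Longrightarrow> F s \<in> Obj C"
  obtains D \<iota> where "is_coproduct C S F D \<iota>"
proof -
  obtain f :: "_ \<Rightarrow> 'u" where f: "inj_on f S"
    using S by (rule small_inj)
  have "\<forall>i\<in>f ` S. F (inv_into S f i) \<in> Obj C"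
    using F inv_into_into[of _ f S] by blast
  then have "\<exists>D \<iota>. is_coproduct C (f ` S) (\<lambda>i. F (inv_into S f i)) D \<iota>"
    by (rule ex_coproduct[OF small_image[OF S]])
  then obtain D \<iota> where "is_coproduct C (f ` S) (\<lambda>i. F (inv_into S f i)) D \<iota>"
    by (elim exE)
  moreover have "bij_betw f S (f ` S)"
    using f by (simp add: bij_betw_def)
  ultimately have "is_coproduct C S (\<lambda>s. F (inv_into S f (f s))) D (\<lambda>s. \<iota> (f s))"
    by (rule is_coproduct_reindex)
  then have "is_coproduct C S F D (\<lambda>s. \<iota> (f s))"
    by (rule is_coproduct_cong) (simp add: inv_into_f_f[OF f])
  then show ?thesis
    by (rule that)
qed

text \<open>The product is the quotient of the coproduct \<open>D\<close> of copies of \<open>G\<close>, one for each family of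
  morphisms \<open>G \<rightarrow> F i\<close>, by the largest subobject on which all the induced \<open>p i\<close> vanish.\<close>

lemma ex_small_product:
  assumes U: "inaccessible U" and G: "generator C G" "projective C G"
    and I: "small U I" and F: "\<And>i. i \<in> I \<Longrightarrow> F i \<in> Obj C"
  obtains Q \<pi> where "is_product C I F Q \<pi>"
proof -
  have G_Obj: "G \<in> Obj C"
    using G(1) unfolding generator_def by blast
  \<comment> \<open>A morphism from \<open>G\<close> to the product must be a family of morphisms
    \<open>G \<rightarrow> F i\<close>; one copy of \<open>G\<close> for each family gives
    \<open>D\<close> all the points that the product has to have.\<close>
  define \<Phi> where "\<Phi> = (\<Pi>\<^sub>E i\<in>I. Hom C G (F i))"
  have "small U \<Phi>"
    unfolding \<Phi>_def by (rule small_PiE[OF U I small_Hom[OF G_Obj F]])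
  then obtain D \<iota> where D: "is_coproduct C \<Phi> (\<lambda>_. G) D \<iota>"
    using ex_small_coproduct[of \<Phi> "\<lambda>_. G", OF _ G_Obj] by metis
  have "\<exists>p. p \<in> Hom C D (F i) \<and> (\<forall>g\<in>\<Phi>. p \<cdot> \<iota> g = g i)" if "i \<in> I" for i
  proof -
    have g: "g i \<in> Hom C G (F i)" if "g \<in> \<Phi>" for g
      using that \<open>i \<in> I\<close> unfolding \<Phi>_def by auto
    show ?thesis
      by (rule coproduct_copair[OF D F[OF that], of "\<lambda>g. g i"]) (use g in auto)
  qed
  then obtain p where p: "\<And>i. i \<in> I \<Longrightarrow> p i \<in> Hom C D (F i)"
      "\<And>i g. i \<in> I \<Longrightarrow> g \<in> \<Phi> \<Longrightarrow> p i \<cdot> \<iota> g = g i"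
    by metis
  \<comment> \<open>These are exactly the points of \<open>D\<close> that the cokernel
    \<open>q\<close> of \<open>u\<close> will kill. Collecting them in a coproduct realises the
    subobject as the image of \<open>u\<close>.\<close>
  define K where "K = {k \<in> Hom C G D. \<forall>i\<in>I. p i \<cdot> k = Zero C G (F i)}"
  have "small U K"
    using small_if_inj_on[of id K "Hom C G D"] small_Hom[OF G_Obj coproductD(1)[OF D]]
    unfolding K_def by auto
  then obtain E \<kappa> where E: "is_coproduct C K (\<lambda>_. G) E \<kappa>"
    using ex_small_coproduct[of K "\<lambda>_. G", OF _ G_Obj] by metis
  have K_Hom: "k \<in> Hom C G D" if "k \<in> K" for k
    using that unfolding K_def by blast
  obtain u where u: "u \<in> Hom C E D" "\<And>k. k \<in> K \<Longrightarrow> u \<cdot> \<kappa> k = k"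
    by (rule coproduct_copair[OF E coproductD(1)[OF D], of "\<lambda>k. k"]) (use K_Hom in auto)
  obtain q where q: "is_cokernel C u q"
    using ex_cokernel HomD(1)[OF u(1)] by blast
  define Q where "Q = Cod C q"
  have qH: "q \<in> Hom C D Q" "q \<cdot> u = Zero C E Q"
    using cokernelD[OF q u(1)] unfolding Q_def by auto
  have "\<exists>\<pi>. \<pi> \<in> Hom C Q (F i) \<and> \<pi> \<cdot> q = p i" if i: "i \<in> I" for i
  proof -
    have "p i \<cdot> u = Zero C E (F i)"
    proof (rule coproduct_eq[OF E Comp_Hom[OF u(1) p(1)[OF i]]])
      show "Zero C E (F i) \<in> Hom C E (F i)"
        using Zero_Hom coproductD(1)[OF E] F[OF i] by blast
      fix k assume k: "k \<in> K"
      have "p i \<cdot> k = Zero C G (F i)"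
        using k i unfolding K_def by blast
      then show "p i \<cdot> u \<cdot> \<kappa> k = Zero C E (F i) \<cdot> \<kappa> k"
        using Comp_assoc[OF coproductD(3)[OF E k] u(1) p(1)[OF i]] u(2)[OF k]
          Zero_Comp[OF coproductD(3)[OF E k] F[OF i]] by simp
    qed
    then show ?thesis
      using cokernel_factor[OF q u(1) p(1)[OF i]] unfolding Q_def by blast
  qed
  then obtain \<pi> where \<pi>: "\<And>i. i \<in> I \<Longrightarrow> \<pi> i \<in> Hom C Q (F i)" "\<And>i. i \<in> I \<Longrightarrow> \<pi> i \<cdot> q = p i"
    by metis
  \<comment> \<open>Lifting a point of \<open>Q\<close> to \<open>D\<close> turns vanishing under
    all \<open>\<pi> i\<close> into membership in \<open>K\<close>.\<close>
  have joint_G: "x = Zero C G Q"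
    if x: "x \<in> Hom C G Q" "\<And>i. i \<in> I \<Longrightarrow> \<pi> i \<cdot> x = Zero C G (F i)" for x
  proof -
    obtain y where y: "y \<in> Hom C G D" "q \<cdot> y = x"
      using projectiveD[OF G(2) cokernel_epi[OF q] qH(1) x(1)] .
    have "p i \<cdot> y = Zero C G (F i)" if "i \<in> I" for i
      using Comp_assoc[OF y(1) qH(1) \<pi>(1)[OF that]] \<pi>(2)[OF that] y(2) x(2)[OF that] by simp
    then have yK: "y \<in> K"
      using y(1) unfolding K_def by blast
    show ?thesis
      using Comp_assoc[OF coproductD(3)[OF E yK] u(1) qH(1)] u(2)[OF yK] y(2) qH(2)
        Zero_Comp[OF coproductD(3)[OF E yK] HomD(5)[OF qH(1)]] by simp
  qed
  have joint_Zero: "x = Zero C t Q"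
    if x: "x \<in> Hom C t Q" "\<And>i. i \<in> I \<Longrightarrow> \<pi> i \<cdot> x = Zero C t (F i)" for x t
  proof (rule generator_separates[OF G(1) x(1)], rule joint_G)
    fix h assume h: "h \<in> Hom C G t"
    show "x \<cdot> h \<in> Hom C G Q"
      using Comp_Hom[OF h x(1)] .
    show "\<pi> i \<cdot> (x \<cdot> h) = Zero C G (F i)" if "i \<in> I" for i
      using Comp_assoc[OF h x(1) \<pi>(1)[OF that]] x(2)[OF that] Zero_Comp[OF h F[OF that]] by simp
  qed
  have joint: "x = y"
    if x: "x \<in> Hom C t Q" and y: "y \<in> Hom C t Q" and eq: "\<And>i. i \<in> I \<Longrightarrow> \<pi> i \<cdot> x = \<pi> i \<cdot> y" for x y t
  proof -
    obtain d where d: "d \<in> Hom C t Q" "d \<oplus>\<oplus> y = x"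
      using difference[OF x y] .
    have "\<pi> i \<cdot> d = Zero C t (F i)" if "i \<in> I" for i
      using Comp_Plus_right[OF d(1) y \<pi>(1)[OF that]] eq[OF that] d(2)
        Plus_cancel_Zero[OF Comp_Hom[OF d(1) \<pi>(1)[OF that]] Comp_Hom[OF y \<pi>(1)[OF that]]] by simp
    then have "d = Zero C t Q"
      using joint_Zero d(1) by blast
    then show ?thesis
      using Plus_cancel_Zero[OF d(1) y] d(2) by simp
  qed
  have "is_product C I F Q \<pi>"
    unfolding is_product_def
  proof (intro conjI ballI allI impI)
    show "Q \<in> Obj C"
      using HomD(5)[OF qH(1)] .
    show "F i \<in> Obj C" "\<pi> i \<in> Hom C Q (F i)" if "i \<in> I" for i
      using F \<pi>(1) that by auto
    fix T g
    assume T: "T \<in> Obj C" and "\<forall>i\<in>I. g i \<in> Hom C T (F i)"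
    then have g: "\<And>i. i \<in> I \<Longrightarrow> g i \<in> Hom C T (F i)"
      by blast
    \<comment> \<open>Morphisms into \<open>Q\<close> are easy to prescribe on copies of
      \<open>G\<close>, so \<open>T\<close> is covered by such copies: the one at \<open>h\<close>
      goes to the summand of \<open>D\<close> that belongs to the family
      \<open>g i \<cdot> h\<close>.\<close>
    obtain W \<omega> where W: "is_coproduct C (Hom C G T) (\<lambda>_. G) W \<omega>"
      using ex_small_coproduct[OF small_Hom[OF G_Obj T], of "\<lambda>_. G", OF G_Obj] .
    obtain e where e: "e \<in> Hom C W T" "\<And>h. h \<in> Hom C G T \<Longrightarrow> e \<cdot> \<omega> h = h"
      using coproduct_copair[OF W T, of "\<lambda>h. h"] by metis
    have epi: "epi_arr C e"
    proof (rule epiI[OF e(1)], rule generator_separates[OF G(1)])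
      fix c x h
      assume x: "x \<in> Hom C T c" "x \<cdot> e = Zero C W c" and h: "h \<in> Hom C G T"
      show "x \<cdot> h = Zero C G c"
        using Comp_assoc[OF coproductD(3)[OF W h] e(1) x(1)] e(2)[OF h] x(2)
          Zero_Comp[OF coproductD(3)[OF W h] HomD(5)[OF x(1)]] by simp
    qed
    \<comment> \<open>Restriction to \<open>I\<close> makes the family extensional, as membership in
      \<open>\<Phi>\<close> demands.\<close>
    define \<phi> where "\<phi> h = (\<lambda>i\<in>I. g i \<cdot> h)" for h
    have \<phi>: "\<phi> h \<in> \<Phi>" if "h \<in> Hom C G T" for h
      using Comp_Hom[OF that g] unfolding \<phi>_def \<Phi>_def by auto
    obtain v where v: "v \<in> Hom C W D" "\<And>h. h \<in> Hom C G T \<Longrightarrow> v \<cdot> \<omega> h = \<iota> (\<phi> h)"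
      using coproduct_copair[OF W coproductD(1)[OF D], of "\<lambda>h. \<iota> (\<phi> h)",
          OF coproductD(3)[OF D \<phi>]] by blast
    have pv: "p i \<cdot> v = g i \<cdot> e" if i: "i \<in> I" for i
    proof (rule coproduct_eq[OF W Comp_Hom[OF v(1) p(1)[OF i]] Comp_Hom[OF e(1) g[OF i]]])
      fix h assume h: "h \<in> Hom C G T"
      show "p i \<cdot> v \<cdot> \<omega> h = g i \<cdot> e \<cdot> \<omega> h"
        using Comp_assoc[OF coproductD(3)[OF W h] v(1) p(1)[OF i]] v(2)[OF h] p(2)[OF i \<phi>[OF h]]
          Comp_assoc[OF coproductD(3)[OF W h] e(1) g[OF i]] e(2)[OF h] i
        by (simp add: \<phi>_def)
    qed
    have qv: "q \<cdot> v \<in> Hom C W Q"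
      using Comp_Hom[OF v(1) qH(1)] .
    have \<pi>qv: "\<pi> i \<cdot> (q \<cdot> v) = g i \<cdot> e" if "i \<in> I" for i
      using Comp_assoc[OF v(1) qH(1) \<pi>(1)[OF that]] \<pi>(2)[OF that] pv[OF that] by simp
    obtain k where k: "is_kernel C e k"
      using ex_kernel HomD(1)[OF e(1)] by blast
    note kH = kernelD[OF k e(1)]
    \<comment> \<open>The choices made on \<open>W\<close> need not respect the relations of
      \<open>T\<close> in \<open>D\<close>; in \<open>Q\<close> they do, because the
      \<open>\<pi> i\<close> jointly detect zero.\<close>
    have "q \<cdot> v \<cdot> k = Zero C (Dom C k) Q"
    proof (rule joint_Zero[OF Comp_Hom[OF kH(1) qv]])
      fix i assume i: "i \<in> I"
      show "\<pi> i \<cdot> (q \<cdot> v \<cdot> k) = Zero C (Dom C k) (F i)"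
        using Comp_assoc[OF kH(1) qv \<pi>(1)[OF i]] \<pi>qv[OF i] Comp_assoc[OF kH(1) e(1) g[OF i]] kH(2)
          Comp_Zero[OF g[OF i] HomD(4)[OF kH(1)]] by simp
    qed
    then obtain w where w: "w \<in> Hom C T Q" "w \<cdot> e = q \<cdot> v"
      using epi_factor_kernel[OF epi e(1) k qv] by blast
    have "\<pi> i \<cdot> w = g i" if i: "i \<in> I" for i
      using epi_cancel[OF epi e(1) Comp_Hom[OF w(1) \<pi>(1)[OF i]] g[OF i]]
        Comp_assoc[OF e(1) w(1) \<pi>(1)[OF i]] w(2) \<pi>qv[OF i] by simp
    then show "\<exists>!h. h \<in> Hom C T Q \<and> (\<forall>i\<in>I. \<pi> i \<cdot> h = g i)"
      using w(1) joint by (intro ex1I[of _ w]) auto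
  qed
  then show ?thesis
    by (rule that)
qed

end


section \<open>Ideals and closed subcategories\<close>

locale compact_projective_generators = grothendieck_category C U
  for C :: "('o, 'a, 'm) add_cat_scheme" (structure) and U :: "'u itself" +
  fixes A :: "'i set" and P :: "'i \<Rightarrow> 'o"
  assumes inaccessible: "inaccessible U"
    and small_index: "small U A"
    and compact: "\<alpha> \<in> A \<Longrightarrow> compact_object C U (P \<alpha>)"
    and projective: "\<alpha> \<in> A \<Longrightarrow> projective C (P \<alpha>)"
    and generators: "set_of_generators C A P"
begin

lemma P_Obj: "\<alpha> \<in> A \<Longrightarrow> P \<alpha> \<in> Obj C"
  using projective unfolding projective_def by blast

lemma ex_projective_generator:
  obtains G where "generator C G" "projective C G"
  using generators projective_coproduct projective unfolding set_of_generators_def by metis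

text \<open>A morphism out of the direct sum of the \<open>P \<alpha>\<close> is determined on the
  summands, so the generating property passes from the sum to the family.\<close>

lemma separates:
  assumes x: "x \<in> Hom C a b"
    and z: "\<And>\<alpha> h. \<alpha> \<in> A \<Longrightarrow> h \<in> Hom C (P \<alpha>) a \<Longrightarrow> x \<cdot> h = Zero C (P \<alpha>) b"
  shows "x = Zero C a b"
proof -
  obtain D \<iota> where D: "is_coproduct C A P D \<iota>" "generator C D"
    using generators unfolding set_of_generators_def by blast
  show ?thesis
  proof (rule generator_separates[OF D(2) x])
    fix h assume h: "h \<in> Hom C D a"
    show "x \<cdot> h = Zero C D b"
    proof (rule coproduct_eq[OF D(1) Comp_Hom[OF h x]])
      show "Zero C D b \<in> Hom C D b"
        using Zero_Hom HomD(4)[OF h] HomD(5)[OF x] by blast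
      fix \<alpha> assume \<alpha>: "\<alpha> \<in> A"
      note \<iota> = coproductD(3)[OF D(1) \<alpha>]
      show "x \<cdot> h \<cdot> \<iota> \<alpha> = Zero C D b \<cdot> \<iota> \<alpha>"
        using Comp_assoc[OF \<iota> h x] z[OF \<alpha> Comp_Hom[OF \<iota> h]] Zero_Comp[OF \<iota> HomD(5)[OF x]] by simp
    qed
  qed
qed

text \<open>Compactness writes \<open>f\<close> as a finitely supported sum of morphisms that pass
  through single summands, and \<open>k\<close> annihilates each term.\<close>

lemma compact_coproduct_Comp_Zero:
  fixes I :: "'u set"
  assumes \<alpha>: "\<alpha> \<in> A" and I: "small U I" and cp: "is_coproduct C I N D \<iota>"
    and f: "f \<in> Hom C (P \<alpha>) D" and k: "k \<in> Hom C c (P \<alpha>)"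
    and z: "\<And>i g. i \<in> I \<Longrightarrow> g \<in> Hom C (P \<alpha>) (N i) \<Longrightarrow> g \<cdot> k = Zero C c (N i)"
  shows "f \<cdot> k = Zero C c D"
proof -
  have gr: "group (hom_group C (P \<alpha>) (N i))" if "i \<in> I" for i
    using comm_group.axioms(2)[OF hom_comm_group] P_Obj[OF \<alpha>] coproductD(2)[OF cp that] by blast
  have "(\<lambda>f. gfinprod (hom_group C (P \<alpha>) D) (\<lambda>i. \<iota> i \<cdot> f i) I) `
      carrier (sum_group I (\<lambda>i. hom_group C (P \<alpha>) (N i))) = carrier (hom_group C (P \<alpha>) D)"
    using compact[OF \<alpha>] I cp unfolding compact_object_def iso_def bij_betw_def by blast
  then obtain x where x: "x \<in> carrier (sum_group I (\<lambda>i. hom_group C (P \<alpha>) (N i)))"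
      "f = gfinprod (hom_group C (P \<alpha>) D) (\<lambda>i. \<iota> i \<cdot> x i) I"
    using f by (auto simp: hom_group_def)
  then have xH: "x i \<in> Hom C (P \<alpha>) (N i)" if "i \<in> I" for i
    using that carrier_sum_group[of I "\<lambda>i. hom_group C (P \<alpha>) (N i)"] gr
    by (auto simp: hom_group_def)
  show ?thesis
    unfolding x(2)
  proof (rule gfinprod_Comp_Zero[OF k coproductD(1)[OF cp]])
    fix i assume i: "i \<in> I"
    note \<iota> = coproductD(3)[OF cp i]
    show "\<iota> i \<cdot> x i \<in> Hom C (P \<alpha>) D"
      using Comp_Hom[OF xH[OF i] \<iota>] .
    show "\<iota> i \<cdot> x i \<cdot> k = Zero C c D"
      using Comp_assoc[OF k xH[OF i] \<iota>] z[OF i xH[OF i]] Comp_Zero[OF \<iota> HomD(4)[OF k]] by simp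
  qed
qed

text \<open>For a single generator this is the class of modules over its endomorphism ring that are
  annihilated by a two-sided ideal. It is stated for chosen monomorphisms \<open>j \<alpha>\<close>,
  so that vanishing on a subobject is an equation between morphisms.\<close>

definition annihilated :: "('i \<Rightarrow> 'a) \<Rightarrow> 'o set" where
  "annihilated j =
     {M \<in> Obj C. \<forall>\<alpha>\<in>A. \<forall>f\<in>Hom C (P \<alpha>) M. f \<cdot> j \<alpha> = Zero C (Dom C (j \<alpha>)) M}"

lemma annihilatedD:
  assumes "M \<in> annihilated j"
  shows "M \<in> Obj C" "\<alpha> \<in> A \<Longrightarrow> f \<in> Hom C (P \<alpha>) M \<Longrightarrow> f \<cdot> j \<alpha> = Zero C (Dom C (j \<alpha>)) M"
  using assms unfolding annihilated_def by auto

lemma closed_annihilated: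
  assumes j: "\<And>\<alpha>. \<alpha> \<in> A \<Longrightarrow> j \<alpha> \<in> Hom C (Dom C (j \<alpha>)) (P \<alpha>)"
  shows "closed_subcategory C U (annihilated j)"
  unfolding closed_subcategory_def weakly_closed_subcategory_def
proof (intro conjI allI impI)
  show "annihilated j \<subseteq> Obj C"
    unfolding annihilated_def by blast
next
  fix m assume m: "mono_arr C m \<and> Cod C m \<in> annihilated j"
  then have mH: "m \<in> Hom C (Dom C m) (Cod C m)"
    using Arr_Hom unfolding mono_arr_def by blast
  have "f \<cdot> j \<alpha> = Zero C (Dom C (j \<alpha>)) (Dom C m)"
    if \<alpha>: "\<alpha> \<in> A" and f: "f \<in> Hom C (P \<alpha>) (Dom C m)" for \<alpha> f
  proof (rule mono_cancel[OF _ mH Comp_Hom[OF j[OF \<alpha>] f]])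
    show "mono_arr C m" using m by blast
    show "Zero C (Dom C (j \<alpha>)) (Dom C m) \<in> Hom C (Dom C (j \<alpha>)) (Dom C m)"
      using Zero_Hom HomD(4)[OF j[OF \<alpha>]] HomD(4)[OF mH] by blast
    show "m \<cdot> (f \<cdot> j \<alpha>) = m \<cdot> Zero C (Dom C (j \<alpha>)) (Dom C m)"
      using Comp_assoc[OF j[OF \<alpha>] f mH] annihilatedD(2)[OF conjunct2[OF m] \<alpha> Comp_Hom[OF f mH]]
        Comp_Zero[OF mH HomD(4)[OF j[OF \<alpha>]]] by simp
  qed
  then show "Dom C m \<in> annihilated j"
    using HomD(4)[OF mH] unfolding annihilated_def by blast
next
  fix e assume e: "epi_arr C e \<and> Dom C e \<in> annihilated j"
  then have eH: "e \<in> Hom C (Dom C e) (Cod C e)"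
    using Arr_Hom unfolding epi_arr_def by blast
  have "f \<cdot> j \<alpha> = Zero C (Dom C (j \<alpha>)) (Cod C e)"
    if \<alpha>: "\<alpha> \<in> A" and f: "f \<in> Hom C (P \<alpha>) (Cod C e)" for \<alpha> f
  proof -
    obtain g where g: "g \<in> Hom C (P \<alpha>) (Dom C e)" "e \<cdot> g = f"
      using projectiveD[OF projective[OF \<alpha>] conjunct1[OF e] eH f] .
    show ?thesis
      using Comp_assoc[OF j[OF \<alpha>] g(1) eH] g(2) annihilatedD(2)[OF conjunct2[OF e] \<alpha> g(1)]
        Comp_Zero[OF eH HomD(4)[OF j[OF \<alpha>]]] by simp
  qed
  then show "Cod C e \<in> annihilated j"
    using HomD(5)[OF eH] unfolding annihilated_def by blast
next
  fix I :: "'u set" and F D \<iota>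
  assume h: "small U I \<and> (\<forall>i\<in>I. F i \<in> annihilated j) \<and> is_coproduct C I F D \<iota>"
  then have cp: "is_coproduct C I F D \<iota>" and I: "small U I"
    by auto
  have "f \<cdot> j \<alpha> = Zero C (Dom C (j \<alpha>)) D"
    if \<alpha>: "\<alpha> \<in> A" and f: "f \<in> Hom C (P \<alpha>) D" for \<alpha> f
    using compact_coproduct_Comp_Zero[OF \<alpha> I cp f j[OF \<alpha>]] annihilatedD(2)[OF _ \<alpha>] h by blast
  then show "D \<in> annihilated j"
    using coproductD(1)[OF cp] unfolding annihilated_def by blast
next
  fix I :: "'u set" and F Q \<pi>
  assume h: "small U I \<and> (\<forall>i\<in>I. F i \<in> annihilated j) \<and> is_product C I F Q \<pi>"
  then have p: "is_product C I F Q \<pi>"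
    by auto
  have "f \<cdot> j \<alpha> = Zero C (Dom C (j \<alpha>)) Q"
    if \<alpha>: "\<alpha> \<in> A" and f: "f \<in> Hom C (P \<alpha>) Q" for \<alpha> f
  proof (rule product_eq[OF p Comp_Hom[OF j[OF \<alpha>] f]])
    show "Zero C (Dom C (j \<alpha>)) Q \<in> Hom C (Dom C (j \<alpha>)) Q"
      using Zero_Hom HomD(4)[OF j[OF \<alpha>]] productD(1)[OF p] by blast
    fix i assume i: "i \<in> I"
    note \<pi> = productD(3)[OF p i]
    have "F i \<in> annihilated j"
      using h i by blast
    then show "\<pi> i \<cdot> (f \<cdot> j \<alpha>) = \<pi> i \<cdot> Zero C (Dom C (j \<alpha>)) Q"
      using Comp_assoc[OF j[OF \<alpha>] f \<pi>] annihilatedD(2)[OF _ \<alpha> Comp_Hom[OF f \<pi>]]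
        Comp_Zero[OF \<pi> HomD(4)[OF j[OF \<alpha>]]] by simp
  qed
  then show "Q \<in> annihilated j"
    using productD(1)[OF p] unfolding annihilated_def by blast
qed

text \<open>The direct sum runs over all pairs of an index \<open>\<alpha>\<close> and a morphism
  \<open>P \<alpha> \<rightarrow> M\<close>. Each such morphism kills \<open>j \<alpha>\<close> and
  descends to the quotient; together they form an epimorphism, since a morphism out of
  \<open>M\<close> that kills all of them is zero by \<open>separates\<close>.\<close>

lemma annihilated_subset_generated:
  assumes j: "\<And>\<alpha>. \<alpha> \<in> A \<Longrightarrow> j \<alpha> \<in> Hom C (Dom C (j \<alpha>)) (P \<alpha>)"
    and q: "\<And>\<alpha>. \<alpha> \<in> A \<Longrightarrow> is_cokernel C (j \<alpha>) (q \<alpha>)"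
  shows "annihilated j \<subseteq> generated_subcategory C U ((\<lambda>\<alpha>. Cod C (q \<alpha>)) ` A)"
proof
  fix M assume M: "M \<in> annihilated j"
  define S where "S = Sigma A (\<lambda>\<alpha>. Hom C (P \<alpha>) M)"
  have S: "small U S"
    unfolding S_def
    by (rule small_Sigma[OF inaccessible small_index small_Hom[OF P_Obj annihilatedD(1)[OF M]]])
  have qH: "q \<alpha> \<in> Hom C (P \<alpha>) (Cod C (q \<alpha>))" if "\<alpha> \<in> A" for \<alpha>
    using cokernelD(1)[OF q[OF that] j[OF that]] .
  have q_Obj: "Cod C (q (fst s)) \<in> Obj C" if "s \<in> S" for s
    using HomD(5)[OF qH[of "fst s"]] that unfolding S_def by auto
  obtain D \<iota> where D: "is_coproduct C S (\<lambda>s. Cod C (q (fst s))) D \<iota>"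
    by (rule ex_small_coproduct[OF S, of "\<lambda>s. Cod C (q (fst s))"]) (use q_Obj in auto)
  have "\<exists>g. g \<in> Hom C (Cod C (q (fst s))) M \<and> g \<cdot> q (fst s) = snd s" if "s \<in> S" for s
  proof -
    have s: "fst s \<in> A" "snd s \<in> Hom C (P (fst s)) M"
      using that unfolding S_def by auto
    show ?thesis
      using cokernel_factor[OF q[OF s(1)] j[OF s(1)] s(2) annihilatedD(2)[OF M s]] by blast
  qed
  then obtain g where g: "\<And>s. s \<in> S \<Longrightarrow> g s \<in> Hom C (Cod C (q (fst s))) M"
      "\<And>s. s \<in> S \<Longrightarrow> g s \<cdot> q (fst s) = snd s"
    by metis
  obtain e where e: "e \<in> Hom C D M" "\<And>s. s \<in> S \<Longrightarrow> e \<cdot> \<iota> s = g s"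
    using coproduct_copair[OF D annihilatedD(1)[OF M] g(1)] by blast
  have epi: "epi_arr C e"
  proof (rule epiI[OF e(1)], rule separates)
    fix c x \<alpha> f
    assume x: "x \<in> Hom C M c" "x \<cdot> e = Zero C D c" and \<alpha>: "\<alpha> \<in> A" and f: "f \<in> Hom C (P \<alpha>) M"
    have s: "(\<alpha>, f) \<in> S"
      using \<alpha> f unfolding S_def by blast
    have \<iota>: "\<iota> (\<alpha>, f) \<in> Hom C (Cod C (q \<alpha>)) D" and gH: "g (\<alpha>, f) \<in> Hom C (Cod C (q \<alpha>)) M"
      using coproductD(3)[OF D s] g(1)[OF s] by auto
    have "x \<cdot> g (\<alpha>, f) = Zero C (Cod C (q \<alpha>)) c"
      using Comp_assoc[OF \<iota> e(1) x(1)] e(2)[OF s] x(2) Zero_Comp[OF \<iota> HomD(5)[OF x(1)]] by simp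
    then show "x \<cdot> f = Zero C (P \<alpha>) c"
      using Comp_assoc[OF qH[OF \<alpha>] gH x(1)] g(2)[OF s] Zero_Comp[OF qH[OF \<alpha>] HomD(5)[OF x(1)]]
      by simp
  qed
  show "M \<in> generated_subcategory C U ((\<lambda>\<alpha>. Cod C (q \<alpha>)) ` A)"
  proof (rule generated_subcategoryI[OF S _ D epi e(1)])
    show "Cod C (q (fst s)) \<in> (\<lambda>\<alpha>. Cod C (q \<alpha>)) ` A" if "s \<in> S" for s
      using that unfolding S_def by auto
  qed
qed

lemma generated_subset_weakly_closed:
  assumes "weakly_closed_subcategory C U Z" "Q \<subseteq> Z"
  shows "generated_subcategory C U Q \<subseteq> Z"
  using assms unfolding generated_subcategory_def weakly_closed_subcategory_def by blast

text \<open>Requiring \<open>Cod C (q \<alpha>)\<close> to be the very object chosen by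
  \<open>quotient_object\<close> makes the generating sets equal, and not merely isomorphic object
  by object.\<close>

definition representatives :: "('i \<Rightarrow> 'a set) \<Rightarrow> ('i \<Rightarrow> 'a) \<Rightarrow> ('i \<Rightarrow> 'a) \<Rightarrow> bool" where
  "representatives J j q \<longleftrightarrow> J \<in> extensional A \<and>
     (\<forall>\<alpha>\<in>A. J \<alpha> = subobject_class C (j \<alpha>) \<and> mono_arr C (j \<alpha>) \<and> Cod C (j \<alpha>) = P \<alpha> \<and>
        is_cokernel C (j \<alpha>) (q \<alpha>) \<and> Cod C (q \<alpha>) = quotient_object C (J \<alpha>))"

lemma ex_representatives:
  assumes "J \<in> (\<Pi>\<^sub>E \<alpha>\<in>A. subobjects C (P \<alpha>))"
  obtains j q where "representatives J j q"
proof -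
  have "\<exists>m q. J \<alpha> = subobject_class C m \<and> mono_arr C m \<and> Cod C m = P \<alpha> \<and>
      is_cokernel C m q \<and> Cod C q = quotient_object C (J \<alpha>)" if "\<alpha> \<in> A" for \<alpha>
    by (rule quotient_object_cokernel[OF PiE_mem[OF assms that]]) blast
  then obtain j q where "\<forall>\<alpha>\<in>A. J \<alpha> = subobject_class C (j \<alpha>) \<and> mono_arr C (j \<alpha>) \<and>
      Cod C (j \<alpha>) = P \<alpha> \<and> is_cokernel C (j \<alpha>) (q \<alpha>) \<and> Cod C (q \<alpha>) = quotient_object C (J \<alpha>)"
    by metis
  moreover have "J \<in> extensional A"
    using assms unfolding PiE_def by blast
  ultimately show ?thesis
    using that unfolding representatives_def by blast
qed

lemma representativesD:
  assumes "representatives J j q" "\<alpha> \<in> A"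
  shows "J \<alpha> = subobject_class C (j \<alpha>)" "mono_arr C (j \<alpha>)" "Cod C (j \<alpha>) = P \<alpha>"
    "is_cokernel C (j \<alpha>) (q \<alpha>)" "j \<alpha> \<in> Hom C (Dom C (j \<alpha>)) (P \<alpha>)"
    "q \<alpha> \<in> Hom C (P \<alpha>) (Cod C (q \<alpha>))" "q \<alpha> \<cdot> j \<alpha> = Zero C (Dom C (j \<alpha>)) (Cod C (q \<alpha>))"
    "Cod C (q \<alpha>) = quotient_object C (J \<alpha>)"
proof -
  show r: "J \<alpha> = subobject_class C (j \<alpha>)" "mono_arr C (j \<alpha>)" "Cod C (j \<alpha>) = P \<alpha>"
    "is_cokernel C (j \<alpha>) (q \<alpha>)" "Cod C (q \<alpha>) = quotient_object C (J \<alpha>)"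
    using assms unfolding representatives_def by auto
  show jH: "j \<alpha> \<in> Hom C (Dom C (j \<alpha>)) (P \<alpha>)"
    using r(2,3) Arr_Hom[of "j \<alpha>"] unfolding mono_arr_def by auto
  show "q \<alpha> \<in> Hom C (P \<alpha>) (Cod C (q \<alpha>))" "q \<alpha> \<cdot> j \<alpha> = Zero C (Dom C (j \<alpha>)) (Cod C (q \<alpha>))"
    using cokernelD[OF r(4) jH] by auto
qed

text \<open>By projectivity every \<open>P \<alpha> \<rightarrow> P \<beta> / J \<beta>\<close> is
  \<open>q \<beta> \<cdot> g\<close> for some \<open>g\<close>. Since \<open>j \<beta>\<close> is
  the kernel of \<open>q \<beta>\<close>, this composite kills \<open>j \<alpha>\<close> precisely
  when \<open>g \<cdot> j \<alpha>\<close> factors through \<open>j \<beta>\<close>.\<close>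

lemma is_ideal_iff:
  assumes J: "representatives J j q"
  shows "is_ideal C A P J \<longleftrightarrow> (\<forall>\<beta>\<in>A. Cod C (q \<beta>) \<in> annihilated j)"
proof -
  note r = representativesD[OF J]
  have "J \<alpha> \<in> subobjects C (P \<alpha>)" if "\<alpha> \<in> A" for \<alpha>
    using r(1,2,3)[OF that] unfolding subobjects_def by blast
  then have "J \<in> (\<Pi>\<^sub>E \<alpha>\<in>A. subobjects C (P \<alpha>))"
    using J unfolding representatives_def PiE_def by blast
  then have "is_ideal C A P J \<longleftrightarrow>
      (\<forall>\<alpha>\<in>A. \<forall>\<beta>\<in>A. \<forall>f\<in>Hom C (P \<alpha>) (P \<beta>). factors_through C (f \<cdot> j \<alpha>) (j \<beta>))"
    unfolding is_ideal_def using r(1) subobject_le_direct_image_iff[OF r(2,3) r(2,3)] by simp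
  also have "\<dots> \<longleftrightarrow> (\<forall>\<beta>\<in>A. \<forall>\<alpha>\<in>A. \<forall>f\<in>Hom C (P \<alpha>) (Cod C (q \<beta>)).
      f \<cdot> j \<alpha> = Zero C (Dom C (j \<alpha>)) (Cod C (q \<beta>)))"
  proof (intro iffI ballI)
    fix \<alpha> \<beta> f
    assume fac: "\<forall>\<alpha>\<in>A. \<forall>\<beta>\<in>A. \<forall>f\<in>Hom C (P \<alpha>) (P \<beta>). factors_through C (f \<cdot> j \<alpha>) (j \<beta>)"
      and \<beta>: "\<beta> \<in> A" and \<alpha>: "\<alpha> \<in> A" and f: "f \<in> Hom C (P \<alpha>) (Cod C (q \<beta>))"
    obtain g where g: "g \<in> Hom C (P \<alpha>) (P \<beta>)" "q \<beta> \<cdot> g = f"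
      using projectiveD[OF projective[OF \<alpha>] cokernel_epi[OF r(4)[OF \<beta>]] r(6)[OF \<beta>] f] .
    obtain h where h: "h \<in> Hom C (Dom C (j \<alpha>)) (Dom C (j \<beta>))" "g \<cdot> j \<alpha> = j \<beta> \<cdot> h"
      using factors_throughD[OF _ Comp_Hom[OF r(5)[OF \<alpha>] g(1)] r(5)[OF \<beta>]] fac \<alpha> \<beta> g(1) by blast
    show "f \<cdot> j \<alpha> = Zero C (Dom C (j \<alpha>)) (Cod C (q \<beta>))"
      using Comp_assoc[OF r(5)[OF \<alpha>] g(1) r(6)[OF \<beta>]] g(2) h(2)
        Comp_assoc[OF h(1) r(5)[OF \<beta>] r(6)[OF \<beta>]] r(7)[OF \<beta>]
        Zero_Comp[OF h(1) HomD(5)[OF r(6)[OF \<beta>]]] by simp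
  next
    fix \<alpha> \<beta> f
    assume z: "\<forall>\<beta>\<in>A. \<forall>\<alpha>\<in>A. \<forall>f\<in>Hom C (P \<alpha>) (Cod C (q \<beta>)).
        f \<cdot> j \<alpha> = Zero C (Dom C (j \<alpha>)) (Cod C (q \<beta>))"
      and \<alpha>: "\<alpha> \<in> A" and \<beta>: "\<beta> \<in> A" and f: "f \<in> Hom C (P \<alpha>) (P \<beta>)"
    note fj = Comp_Hom[OF r(5)[OF \<alpha>] f]
    have "q \<beta> \<cdot> (f \<cdot> j \<alpha>) = Zero C (Dom C (j \<alpha>)) (Cod C (q \<beta>))"
      using Comp_assoc[OF r(5)[OF \<alpha>] f r(6)[OF \<beta>]] z \<alpha> \<beta> Comp_Hom[OF f r(6)[OF \<beta>]] by simp
    then obtain h where "h \<in> Hom C (Dom C (j \<alpha>)) (Dom C (j \<beta>))" "j \<beta> \<cdot> h = f \<cdot> j \<alpha>"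
      using mono_factor_cokernel[OF r(2,5,4)[OF \<beta>] fj] \<beta> by blast
    then show "factors_through C (f \<cdot> j \<alpha>) (j \<beta>)"
      using factors_throughI[OF fj r(5)[OF \<beta>]] by metis
  qed
  finally show ?thesis
    using HomD(5)[OF r(6)] unfolding annihilated_def by auto
qed

lemma ideal_subcategory_eq_annihilated:
  assumes J: "representatives J j q" and ideal: "is_ideal C A P J"
  shows "ideal_subcategory C U A J = annihilated j"
proof -
  note r = representativesD[OF J]
  have eq: "(\<lambda>\<alpha>. quotient_object C (J \<alpha>)) ` A = (\<lambda>\<alpha>. Cod C (q \<alpha>)) ` A"
    using r(8) by auto
  have "weakly_closed_subcategory C U (annihilated j)"
    using closed_annihilated[of j] r(5) unfolding closed_subcategory_def by blast
  moreover have "(\<lambda>\<alpha>. Cod C (q \<alpha>)) ` A \<subseteq> annihilated j"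
    using ideal is_ideal_iff[OF J] by blast
  ultimately show ?thesis
    unfolding ideal_subcategory_def eq
    using generated_subset_weakly_closed annihilated_subset_generated[OF r(5,4)] by blast
qed

lemma closed_ideal_subcategory:
  assumes "is_ideal C A P J"
  shows "closed_subcategory C U (ideal_subcategory C U A J)"
proof -
  obtain j q where J: "representatives J j q"
    using ex_representatives[of J] assms unfolding is_ideal_def by blast
  show ?thesis
    unfolding ideal_subcategory_eq_annihilated[OF J assms]
    using closed_annihilated[of j] representativesD(5)[OF J] by blast
qed

text \<open>The quotient of \<open>P \<alpha>\<close> by \<open>K \<alpha>\<close> lies in the class
  of \<open>K\<close>, hence in that of \<open>J\<close>. Its quotient map therefore kills
  \<open>j \<alpha>\<close>, which means that \<open>J \<alpha>\<close> is contained in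
  \<open>K \<alpha>\<close>; the other inclusion is symmetric.\<close>

lemma ideal_subcategory_inj: "inj_on (ideal_subcategory C U A) {J. is_ideal C A P J}"
proof (rule inj_onI, clarsimp)
  fix J K
  assume ideal: "is_ideal C A P J" "is_ideal C A P K"
    and eq: "ideal_subcategory C U A J = ideal_subcategory C U A K"
  obtain j q where J: "representatives J j q"
    using ex_representatives[of J] ideal(1) unfolding is_ideal_def by blast
  obtain k r where K: "representatives K k r"
    using ex_representatives[of K] ideal(2) unfolding is_ideal_def by blast
  have ann: "annihilated j = annihilated k"
    using eq ideal_subcategory_eq_annihilated J K ideal by metis
  have fac: "factors_through C (j \<alpha>) (k \<alpha>)"
    if J: "representatives J j q" and K: "representatives K k r" and K_ideal: "is_ideal C A P K"
      and ann: "annihilated j = annihilated k" and \<alpha>: "\<alpha> \<in> A" for J K j k q r \<alpha>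
  proof -
    note J = representativesD[OF J \<alpha>] and K' = representativesD[OF K \<alpha>]
    have "Cod C (r \<alpha>) \<in> annihilated j"
      using K_ideal is_ideal_iff[OF K] ann \<alpha> by blast
    then have "r \<alpha> \<cdot> j \<alpha> = Zero C (Dom C (j \<alpha>)) (Cod C (r \<alpha>))"
      using annihilatedD(2) \<alpha> K'(6) by blast
    then obtain h where "h \<in> Hom C (Dom C (j \<alpha>)) (Dom C (k \<alpha>))" "k \<alpha> \<cdot> h = j \<alpha>"
      using mono_factor_cokernel[OF K'(2,5,4) J(5)] by blast
    then show ?thesis
      using factors_throughI[OF J(5) K'(5)] by metis
  qed
  show "J = K"
  proof (rule extensionalityI)
    show "J \<in> extensional A" "K \<in> extensional A"
      using J K unfolding representatives_def by auto
    fix \<alpha> assume \<alpha>: "\<alpha> \<in> A"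
    note J' = representativesD[OF J \<alpha>] and K' = representativesD[OF K \<alpha>]
    show "J \<alpha> = K \<alpha>"
      using subobject_class_eqI[OF J'(2) K'(2)] J'(1,3) K'(1,3)
        fac[OF J K ideal(2) ann \<alpha>] fac[OF K J ideal(1) ann[symmetric] \<alpha>] by simp
  qed
qed

text \<open>The least subobject of \<open>b\<close> with quotient in \<open>Z\<close> is the kernel of a map from \<open>b\<close> to a product
  of objects of \<open>Z\<close>. The maps from \<open>b\<close> to objects of \<open>Z\<close> form a proper class, but only the small set
  of their kernels matters, encoded by their sets of \<open>G\<close>-valued points.\<close>

lemma closed_subcategory_least_subobject:
  assumes Z: "closed_subcategory C U Z" and b: "b \<in> Obj C"
  obtains n q where "mono_arr C n" "Cod C n = b" "is_cokernel C n q" "Cod C q \<in> Z"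
    "\<And>M f. M \<in> Z \<Longrightarrow> f \<in> Hom C b M \<Longrightarrow> f \<cdot> n = Zero C (Dom C n) M"
proof -
  obtain G where G: "generator C G" "projective C G"
    using ex_projective_generator .
  then have G_Obj: "G \<in> Obj C"
    unfolding generator_def by blast
  define pts where "pts M f = {h \<in> Hom C G b. f \<cdot> h = Zero C G M}" for M f
  define I where "I = {pts M f |M f. M \<in> Z \<and> f \<in> Hom C b M}"
  have "I \<subseteq> Pow (Hom C G b)"
    unfolding I_def pts_def by blast
  then have I: "small U I"
    using small_if_inj_on[of id I "Pow (Hom C G b)"] small_Pow[OF inaccessible small_Hom[OF G_Obj b]]
    by simp
  have "\<exists>M f. M \<in> Z \<and> f \<in> Hom C b M \<and> S = pts M f" if "S \<in> I" for S
    using that unfolding I_def by blast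
  then obtain M \<phi> where M: "\<And>S. S \<in> I \<Longrightarrow> M S \<in> Z" "\<And>S. S \<in> I \<Longrightarrow> \<phi> S \<in> Hom C b (M S)"
      "\<And>S. S \<in> I \<Longrightarrow> S = pts (M S) (\<phi> S)"
    by metis
  obtain Q \<pi> where Q: "is_product C I M Q \<pi>"
    using ex_small_product[OF inaccessible G I, of M] HomD(5)[OF M(2)] by blast
  have QZ: "Q \<in> Z"
    using closed_product[OF Z I M(1) Q] .
  obtain f where f: "f \<in> Hom C b Q" "\<And>S. S \<in> I \<Longrightarrow> \<pi> S \<cdot> f = \<phi> S"
    using product_pair[OF Q b M(2)] by blast
  obtain n where n: "is_kernel C f n"
    using ex_kernel HomD(1)[OF f(1)] by blast
  note nH = kernelD[OF n f(1)]
  obtain q where q: "is_cokernel C n q"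
    using ex_cokernel HomD(1)[OF nH(1)] by blast
  obtain g where g: "g \<in> Hom C (Cod C q) Q" "g \<cdot> q = f"
    using cokernel_factor[OF q nH(1) f(1) nH(2)] .
  \<comment> \<open>The quotient of \<open>b\<close> by \<open>n\<close> thus embeds into
    \<open>Q\<close>, an object of \<open>Z\<close>, and closure under subobjects applies.\<close>
  have "mono_arr C g"
    using coimage_mono[OF G f(1) n q g] .
  then have "Cod C q \<in> Z"
    using Z QZ HomD(2,3)[OF g(1)] unfolding closed_subcategory_def weakly_closed_subcategory_def
    by metis
  moreover have "f' \<cdot> n = Zero C (Dom C n) M'" if M': "M' \<in> Z" and f': "f' \<in> Hom C b M'" for M' f'
  proof (rule generator_separates[OF G(1) Comp_Hom[OF nH(1) f']])
    fix h assume h: "h \<in> Hom C G (Dom C n)"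
    note nh = Comp_Hom[OF h nH(1)]
    \<comment> \<open>The morphism \<open>f'\<close> need not be the chosen \<open>\<phi> S\<close>,
      but both kill the same \<open>G\<close>-points of \<open>b\<close>, and the claim is tested on
      such points.\<close>
    define S where "S = pts M' f'"
    have S: "S \<in> I"
      using M' f' unfolding I_def S_def by blast
    note \<pi> = productD(3)[OF Q S]
    have "f \<cdot> (n \<cdot> h) = Zero C G Q"
      using Comp_assoc[OF h nH(1) f(1)] nH(2) Zero_Comp[OF h productD(1)[OF Q]] by simp
    then have "\<phi> S \<cdot> (n \<cdot> h) = Zero C G (M S)"
      using Comp_assoc[OF nh f(1) \<pi>] f(2)[OF S] Comp_Zero[OF \<pi> G_Obj] by simp
    then have "n \<cdot> h \<in> pts (M S) (\<phi> S)"
      using nh unfolding pts_def by blast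
    then have "f' \<cdot> (n \<cdot> h) = Zero C G M'"
      using M(3)[OF S] unfolding S_def pts_def by blast
    then show "f' \<cdot> n \<cdot> h = Zero C G M'"
      using Comp_assoc[OF h nH(1) f'] by simp
  qed
  ultimately show ?thesis
    using that[of n q] kernel_mono[OF n] HomD(3)[OF nH(1)] q by blast
qed

text \<open>The ideal consists of the least subobjects attached to \<open>Z\<close>. Morphisms into
  \<open>Z\<close> kill them, so \<open>Z\<close> lies in the annihilated class; the quotients by
  them lie in \<open>Z\<close>, and so does all that they generate. Together these two facts also
  yield the ideal condition.\<close>

lemma ideal_subcategory_surj:
  assumes Z: "closed_subcategory C U Z"
  obtains J where "is_ideal C A P J" "ideal_subcategory C U A J = Z"
proof -
  have wZ: "weakly_closed_subcategory C U Z"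
    using Z unfolding closed_subcategory_def by blast
  define least where "least \<alpha> n \<longleftrightarrow> mono_arr C n \<and> Cod C n = P \<alpha> \<and>
      (\<exists>p. is_cokernel C n p \<and> Cod C p \<in> Z) \<and>
      (\<forall>M\<in>Z. \<forall>f\<in>Hom C (P \<alpha>) M. f \<cdot> n = Zero C (Dom C n) M)" for \<alpha> n
  have "\<forall>\<alpha>\<in>A. \<exists>n. least \<alpha> n"
    unfolding least_def using closed_subcategory_least_subobject[OF Z P_Obj] by metis
  then obtain n where least: "\<And>\<alpha>. \<alpha> \<in> A \<Longrightarrow> least \<alpha> (n \<alpha>)"
    using bchoice[of A least] by blast
  have n: "mono_arr C (n \<alpha>)" "Cod C (n \<alpha>) = P \<alpha>"
      "\<exists>p. is_cokernel C (n \<alpha>) p \<and> Cod C p \<in> Z"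
      "M \<in> Z \<Longrightarrow> f \<in> Hom C (P \<alpha>) M \<Longrightarrow> f \<cdot> n \<alpha> = Zero C (Dom C (n \<alpha>)) M"
    if "\<alpha> \<in> A" for \<alpha> M f
    using least[OF that] unfolding least_def by auto
  have nH: "n \<alpha> \<in> Hom C (Dom C (n \<alpha>)) (P \<alpha>)" if "\<alpha> \<in> A" for \<alpha>
    using n(1,2)[OF that] Arr_Hom[of "n \<alpha>"] unfolding mono_arr_def by auto
  define J where "J = (\<lambda>\<alpha>\<in>A. subobject_class C (n \<alpha>))"
  have "J \<in> (\<Pi>\<^sub>E \<alpha>\<in>A. subobjects C (P \<alpha>))"
    using n(1,2) unfolding J_def subobjects_def by auto
  \<comment> \<open>The representatives \<open>j \<alpha>\<close> imposed by
    \<open>quotient_object\<close> may differ from \<open>n \<alpha>\<close>. The two factor through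
    each other, and this transfers the properties of \<open>n \<alpha>\<close>.\<close>
  then obtain j q where J: "representatives J j q"
    using ex_representatives by blast
  note r = representativesD[OF J]
  have jn: "factors_through C (j \<alpha>) (n \<alpha>)" and nj: "factors_through C (n \<alpha>) (j \<alpha>)"
    if "\<alpha> \<in> A" for \<alpha>
    using subobject_class_mem[OF r(2)[OF that]] r(1)[OF that] that
    unfolding J_def subobject_class_def by auto
  have Z_ann: "Z \<subseteq> annihilated j"
  proof
    fix M assume M: "M \<in> Z"
    have "f \<cdot> j \<alpha> = Zero C (Dom C (j \<alpha>)) M" if \<alpha>: "\<alpha> \<in> A" and f: "f \<in> Hom C (P \<alpha>) M" for \<alpha> f
    proof -
      obtain h where h: "h \<in> Hom C (Dom C (j \<alpha>)) (Dom C (n \<alpha>))" "j \<alpha> = n \<alpha> \<cdot> h"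
        using factors_throughD[OF jn[OF \<alpha>] r(5)[OF \<alpha>] nH[OF \<alpha>]] .
      show ?thesis
        using Comp_assoc[OF h(1) nH[OF \<alpha>] f] h(2) n(4)[OF \<alpha> M f] Zero_Comp[OF h(1) HomD(5)[OF f]]
        by simp
    qed
    then show "M \<in> annihilated j"
      using M wZ unfolding annihilated_def weakly_closed_subcategory_def by blast
  qed
  have qZ: "Cod C (q \<alpha>) \<in> Z" if \<alpha>: "\<alpha> \<in> A" for \<alpha>
  proof -
    obtain p where p: "is_cokernel C (n \<alpha>) p" "Cod C p \<in> Z"
      using n(3)[OF \<alpha>] by blast
    obtain h where h: "h \<in> Hom C (Dom C (n \<alpha>)) (Dom C (j \<alpha>))" "n \<alpha> = j \<alpha> \<cdot> h"
      using factors_throughD[OF nj[OF \<alpha>] nH[OF \<alpha>] r(5)[OF \<alpha>]] .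
    have "q \<alpha> \<cdot> n \<alpha> = Zero C (Dom C (n \<alpha>)) (Cod C (q \<alpha>))"
      using Comp_assoc[OF h(1) r(5)[OF \<alpha>] r(6)[OF \<alpha>]] h(2) r(7)[OF \<alpha>]
        Zero_Comp[OF h(1) HomD(5)[OF r(6)[OF \<alpha>]]] by simp
    \<comment> \<open>Closure under quotients is applied to \<open>s\<close>: it is an epimorphism
      because \<open>q \<alpha>\<close> is, and its domain \<open>Cod C p\<close> lies in
      \<open>Z\<close>.\<close>
    then obtain s where s: "s \<in> Hom C (Cod C p) (Cod C (q \<alpha>))" "s \<cdot> p = q \<alpha>"
      using cokernel_factor[OF p(1) nH[OF \<alpha>] r(6)[OF \<alpha>]] by blast
    have "epi_arr C s"
      using epi_of_comp[OF _ cokernelD(1)[OF p(1) nH[OF \<alpha>]] s(1)]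
        cokernel_epi[OF r(4)[OF \<alpha>]] s(2) by simp
    then show ?thesis
      using wZ p(2) HomD(2,3)[OF s(1)] unfolding weakly_closed_subcategory_def by metis
  qed
  have ideal: "is_ideal C A P J"
    using is_ideal_iff[OF J] qZ Z_ann by blast
  have "(\<lambda>\<alpha>. Cod C (q \<alpha>)) ` A \<subseteq> Z"
    using qZ by blast
  from annihilated_subset_generated[OF r(5,4)] generated_subset_weakly_closed[OF wZ this]
  have "annihilated j \<subseteq> Z"
    by (rule order_trans)
  then have "ideal_subcategory C U A J = Z"
    using ideal_subcategory_eq_annihilated[OF J ideal] Z_ann by blast
  with ideal show ?thesis
    by (rule that)
qed

lemma ideal_subcategory_bij_betw:
  "bij_betw (ideal_subcategory C U A) {J. is_ideal C A P J} {Z. closed_subcategory C U Z}"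
  unfolding bij_betw_def
  using ideal_subcategory_inj closed_ideal_subcategory ideal_subcategory_surj by fastforce

end

theorem theorem1p1:
  fixes X :: "('o, 'a) add_cat" and U :: "'u itself" and A :: "'i set" and P :: "'i \<Rightarrow> 'o"
  assumes "inaccessible U"
    and "grothendieck_category X U"
    and "small U A"
    and "\<forall>\<alpha> \<in> A. compact_object X U (P \<alpha>) \<and> projective X (P \<alpha>)"
    and "set_of_generators X A P"
  shows "(\<forall>Z. closed_subcategory X U Z \<longrightarrow>
            (\<exists>!J. is_ideal X A P J \<and> Z = ideal_subcategory X U A J)) \<and>
         bij_betw (ideal_subcategory X U A) {J. is_ideal X A P J} {Z. closed_subcategory X U Z}"
proof -
  interpret grothendieck_category X U
    by (rule assms(2))
  interpret compact_projective_generators X U A P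
    by unfold_locales (use assms in auto)
  have "\<exists>!J. is_ideal X A P J \<and> Z = ideal_subcategory X U A J" if "closed_subcategory X U Z" for Z
    using ideal_subcategory_surj[OF that] ideal_subcategory_inj unfolding inj_on_def by blast
  then show ?thesis
    using ideal_subcategory_bij_betw by blast
qed

end
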